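(* Let $E$ be a full Hilbert $\mathcal{B}$-module over a $C^*$-algebra $\mathcal{B}$, and let $\vartheta$ and $\vartheta'$ be two strict $E_0$-semigroups on $\mathscr{B}^a(E)$. Then their associated product systems $E^\odot$ and $E'^\odot$ are isomorphic if and only if $\vartheta$ and $\vartheta'$ are unitary cocycle equivalent.
   Context: The index semigroup $\mathbb{S}$ is $\mathbb{N}_0$ or $\mathbb{R}_+$. For a Hilbert $\mathcal{B}$-module $E$, $\mathscr{B}^a(E)$ denotes the adjointable operators, $xy^*$ the operator $z\mapsto x\langle y,z\rangle$, $\mathscr{K}(E)$ the closed span of all $xy^*$. $E$ is full if $\overline{\mathrm{span}}\,\langle E,E\rangle=\mathcal{B}$. A correspondence over $\mathcal{B}$ is a Hilbert $\mathcal{B}$-module with a nondegenerate left action of $\mathcal{B}$ by adjointable operators; $\odot$ is the interior tensor product. An $E_0$-semigroup on $\mathscr{B}^a(E)$ is a semigroup $(\vartheta_t)_{t\in\mathbb{S}}$ of unital $*$-endomorphisms with $\vartheta_0=\mathrm{id}$; it is strict if $\overline{\mathrm{span}}\,\vartheta_t(\mathscr{K}(E))E=E$ for every $t$. Product system of $\mathcal{B}$-correspondences: a family $E^\odot=(E_t)_{t\in\mathbb{S}}$ of correspondences over $\mathcal{B}$ with $E_0=\mathcal{B}$ and bilinear unitaries $u_{s,t}\colon E_s\odot E_t\to E_{s+t}$ such that $x_sy_t:=u_{s,t}(x_s\odot y_t)$ is associative and $u_{0,t},u_{t,0}$ are the canonical left and right action. Isomorphism: bilinear unitaries $w_t\colon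 E_t\to F_t$ with $w_0=\mathrm{id}_{\mathcal B}$, $w_s(x_s)w_t(y_t)=w_{s+t}(x_sy_t)$. The product system associated with strict $\vartheta$ on $\mathscr{B}^a(E)$: $E_t$ is the closed span of elements $x^*\odot_ty$ ($x,y\in E$) with $\langle x^*\odot_ty,x'^*\odot_ty'\rangle=\langle y,\vartheta_t(xx'^* )y'\rangle$, right action on $y$, left action $b(x^*\odot_ty)=(xb^* )^*\odot_ty$, product $(x^*\odot_sx')(y^*\odot_ty')=x^*\odot_{s+t}\vartheta_t(x'y^* )y'$, and $E_0=\mathcal{B}$ via $x^*\odot_0y=\langle x,y\rangle$. $\vartheta$ and $\vartheta'$ are unitary cocycle equivalent if there is a family of unitaries $u_t\in\mathscr{B}^a(E)$ with $u_0=\mathbf{1}$, $u_{s+t}=u_s\vartheta_s(u_t)$ and $\vartheta'_t(a)=u_t\vartheta_t(a)u_t^*$ for all $s,t\in\mathbb{S}$, $a\in\mathscr{B}^a(E)$. *)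

theory Defs
  imports "HOL-Analysis.Analysis"
begin

section \<open>Complex normed spaces and C*-algebras\<close>

class complex_vector = real_vector +
  fixes scaleC :: "complex \<Rightarrow> 'a \<Rightarrow> 'a"  (infixr \<open>*\<^sub>C\<close> 75)
  assumes scaleC_add_right: "c *\<^sub>C (x + y) = c *\<^sub>C x + c *\<^sub>C y"
    and scaleC_add_left: "(c + d) *\<^sub>C x = c *\<^sub>C x + d *\<^sub>C x"
    and scaleC_scaleC: "c *\<^sub>C d *\<^sub>C x = (c * d) *\<^sub>C x"
    and scaleC_of_real: "complex_of_real r *\<^sub>C x = r *\<^sub>R x"

global_interpretation complex_vector: vector_space "scaleC :: complex \<Rightarrow> 'a \<Rightarrow> 'a::complex_vector"
proof
  show "1 *\<^sub>C x = x" for x :: 'a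
    using scaleC_of_real[of 1 x] by simp
qed (simp_all add: scaleC_add_right scaleC_add_left scaleC_scaleC)

abbreviation csubspace :: "'a::complex_vector set \<Rightarrow> bool"
  where "csubspace \<equiv> complex_vector.subspace"

abbreviation cspan :: "'a::complex_vector set \<Rightarrow> 'a set"
  where "cspan \<equiv> complex_vector.span"

class complex_normed_vector = complex_vector + real_normed_vector +
  assumes norm_scaleC: "norm (c *\<^sub>C x) = cmod c * norm x"

text \<open>C*-algebras; a unit is not required.\<close>

class cstar_algebra = complex_normed_vector + banach + real_normed_algebra +
  fixes star :: "'a \<Rightarrow> 'a"
  assumes scaleC_mult_left: "(c *\<^sub>C x) * y = c *\<^sub>C (x * y)"
    and scaleC_mult_right: "x * (c *\<^sub>C y) = c *\<^sub>C (x * y)"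
    and star_add: "star (x + y) = star x + star y"
    and star_scaleC: "star (c *\<^sub>C x) = cnj c *\<^sub>C star x"
    and star_mult: "star (x * y) = star y * star x"
    and star_star: "star (star x) = x"
    and cstar_identity: "norm (star x * x) = (norm x)\<^sup>2"

definition cstar_positive :: "'b::cstar_algebra \<Rightarrow> bool"
  where "cstar_positive a \<longleftrightarrow> (\<exists>c. a = star c * c)"


section \<open>Hilbert modules\<close>

text \<open>
  The members of a family of Hilbert modules (the fibres of a product system) must live in one
  HOL type. A Hilbert module is therefore given on a complete subspace \<open>carr M\<close> of an ambient
  normed space, the ambient norm on \<open>carr M\<close> being the Hilbert module norm. This is no
  restriction: any family of Banach spaces embeds isometrically into its \<open>\<ell>\<^sup>\<infinity>\<close>-sum.
  Inner products and actions belong to the individual module and are only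
  meaningful on its carrier. Inner products are linear in the second argument.
\<close>

record ('b, 'e) hmodule =
  carr :: "'e set"
  inn :: "'e \<Rightarrow> 'e \<Rightarrow> 'b"
  ract :: "'e \<Rightarrow> 'b \<Rightarrow> 'e"

locale hilbert_module =
  fixes M :: "('b::cstar_algebra, 'e::complex_normed_vector, 'm) hmodule_scheme"
  assumes carr_subspace: "csubspace (carr M)"
    and ract_closed: "x \<in> carr M \<Longrightarrow> ract M x b \<in> carr M"
    and ract_add_left: "\<lbrakk>x \<in> carr M; y \<in> carr M\<rbrakk> \<Longrightarrow> ract M (x + y) b = ract M x b + ract M y b"
    and ract_add_right: "x \<in> carr M \<Longrightarrow> ract M x (a + b) = ract M x a + ract M x b"
    and ract_scaleC_left: "x \<in> carr M \<Longrightarrow> ract M (c *\<^sub>C x) b = c *\<^sub>C ract M x b"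
    and ract_scaleC_right: "x \<in> carr M \<Longrightarrow> ract M x (c *\<^sub>C b) = c *\<^sub>C ract M x b"
    and ract_mult: "x \<in> carr M \<Longrightarrow> ract M x (a * b) = ract M (ract M x a) b"
    and inn_add_right: "\<lbrakk>x \<in> carr M; y \<in> carr M; z \<in> carr M\<rbrakk> \<Longrightarrow> inn M x (y + z) = inn M x y + inn M x z"
    and inn_scaleC_right: "\<lbrakk>x \<in> carr M; y \<in> carr M\<rbrakk> \<Longrightarrow> inn M x (c *\<^sub>C y) = c *\<^sub>C inn M x y"
    and inn_ract_right: "\<lbrakk>x \<in> carr M; y \<in> carr M\<rbrakk> \<Longrightarrow> inn M x (ract M y b) = inn M x y * b"
    and star_inn: "\<lbrakk>x \<in> carr M; y \<in> carr M\<rbrakk> \<Longrightarrow> star (inn M x y) = inn M y x"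
    and inn_positive: "x \<in> carr M \<Longrightarrow> cstar_positive (inn M x x)"
    and inn_definite: "\<lbrakk>x \<in> carr M; inn M x x = 0\<rbrakk> \<Longrightarrow> x = 0"
    and norm_inn: "x \<in> carr M \<Longrightarrow> norm x = sqrt (norm (inn M x x))"
    and carr_complete: "complete (carr M)"

definition full :: "('b::cstar_algebra, 'e::complex_normed_vector, 'm) hmodule_scheme \<Rightarrow> bool"
  where "full M \<longleftrightarrow> closure (cspan {inn M x y | x y. x \<in> carr M \<and> y \<in> carr M}) = UNIV"

definition is_adjoint ::
  "('b::cstar_algebra, 'e::complex_normed_vector, 'm) hmodule_scheme
   \<Rightarrow> ('b, 'f::complex_normed_vector, 'n) hmodule_scheme \<Rightarrow> ('e \<Rightarrow> 'f) \<Rightarrow> ('f \<Rightarrow> 'e) \<Rightarrow> bool"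
  where "is_adjoint M N a a' \<longleftrightarrow>
    (\<forall>x\<in>carr M. a x \<in> carr N) \<and> (\<forall>y\<in>carr N. a' y \<in> carr M) \<and>
    (\<forall>x\<in>carr M. \<forall>y\<in>carr N. inn N (a x) y = inn M x (a' y))"

definition hunitary ::
  "('b::cstar_algebra, 'e::complex_normed_vector, 'm) hmodule_scheme
   \<Rightarrow> ('b, 'f::complex_normed_vector, 'n) hmodule_scheme \<Rightarrow> ('e \<Rightarrow> 'f) \<Rightarrow> bool"
  where "hunitary M N u \<longleftrightarrow>
    (\<exists>u'. is_adjoint M N u u' \<and> (\<forall>x\<in>carr M. u' (u x) = x) \<and> (\<forall>y\<in>carr N. u (u' y) = y))"


section \<open>Operators on a Hilbert module and \<open>E\<^sub>0\<close>-semigroups\<close>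

text \<open>
  The notions of this section are used only for modules \<open>E\<close> that exhaust their type
  (\<open>carr E = UNIV\<close>), so that operators are HOL functions and equality of operators is HOL
  equality.
\<close>

definition Ba :: "('b::cstar_algebra, 'e::complex_normed_vector, 'm) hmodule_scheme \<Rightarrow> ('e \<Rightarrow> 'e) set"
  where "Ba E = {a. \<exists>a'. is_adjoint E E a a'}"

definition adj :: "('b::cstar_algebra, 'e::complex_normed_vector, 'm) hmodule_scheme
    \<Rightarrow> ('e \<Rightarrow> 'e) \<Rightarrow> 'e \<Rightarrow> 'e"
  where "adj E a = (THE a'. is_adjoint E E a a')"

text \<open>The operator \<open>x y\<^sup>*\<close>.\<close>

definition rank1 :: "('b::cstar_algebra, 'e::complex_normed_vector, 'm) hmodule_scheme
    \<Rightarrow> 'e \<Rightarrow> 'e \<Rightarrow> 'e \<Rightarrow> 'e"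
  where "rank1 E x y = (\<lambda>z. ract E x (inn E y z))"

definition finite_rank :: "('b::cstar_algebra, 'e::complex_normed_vector, 'm) hmodule_scheme
    \<Rightarrow> ('e \<Rightarrow> 'e) set"
  where "finite_rank E =
    {\<lambda>z. \<Sum>i<n. c i *\<^sub>C rank1 E (x i) (y i) z | (n::nat) (c :: nat \<Rightarrow> complex) x y.
       \<forall>i<n. x i \<in> carr E \<and> y i \<in> carr E}"

text \<open>Closure in the operator norm; adjointable operators are bounded, so \<open>onorm\<close> is
  their operator norm.\<close>

definition Kop :: "('b::cstar_algebra, 'e::complex_normed_vector, 'm) hmodule_scheme
    \<Rightarrow> ('e \<Rightarrow> 'e) set"
  where "Kop E = {a \<in> Ba E. \<forall>\<epsilon>>0. \<exists>k\<in>finite_rank E. onorm (\<lambda>z. a z - k z) < \<epsilon>}"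

text \<open>The additive semigroup \<open>S\<close> of times is a subset of the reals.\<close>

locale E0_semigroup =
  fixes S :: "real set"
    and E :: "('b::cstar_algebra, 'e::complex_normed_vector, 'm) hmodule_scheme"
    and \<theta> :: "real \<Rightarrow> ('e \<Rightarrow> 'e) \<Rightarrow> ('e \<Rightarrow> 'e)"
  assumes maps_Ba: "\<lbrakk>t \<in> S; a \<in> Ba E\<rbrakk> \<Longrightarrow> \<theta> t a \<in> Ba E"
    and add: "\<lbrakk>t \<in> S; a \<in> Ba E; b \<in> Ba E\<rbrakk> \<Longrightarrow> \<theta> t (\<lambda>x. a x + b x) = (\<lambda>x. \<theta> t a x + \<theta> t b x)"
    and scale: "\<lbrakk>t \<in> S; a \<in> Ba E\<rbrakk> \<Longrightarrow> \<theta> t (\<lambda>x. c *\<^sub>C a x) = (\<lambda>x. c *\<^sub>C \<theta> t a x)"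
    and mult: "\<lbrakk>t \<in> S; a \<in> Ba E; b \<in> Ba E\<rbrakk> \<Longrightarrow> \<theta> t (a \<circ> b) = \<theta> t a \<circ> \<theta> t b"
    and adjoint: "\<lbrakk>t \<in> S; a \<in> Ba E\<rbrakk> \<Longrightarrow> \<theta> t (adj E a) = adj E (\<theta> t a)"
    and unital: "t \<in> S \<Longrightarrow> \<theta> t id = id"
    and zero: "a \<in> Ba E \<Longrightarrow> \<theta> 0 a = a"
    and semigroup: "\<lbrakk>s \<in> S; t \<in> S; a \<in> Ba E\<rbrakk> \<Longrightarrow> \<theta> (s + t) a = \<theta> s (\<theta> t a)"

definition strict :: "real set \<Rightarrow> ('b::cstar_algebra, 'e::complex_normed_vector, 'm) hmodule_scheme
    \<Rightarrow> (real \<Rightarrow> ('e \<Rightarrow> 'e) \<Rightarrow> ('e \<Rightarrow> 'e)) \<Rightarrow> bool"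
  where "strict S E \<theta> \<longleftrightarrow>
    (\<forall>t\<in>S. closure (cspan {\<theta> t k x | k x. k \<in> Kop E \<and> x \<in> carr E}) = carr E)"

definition cocycle_equivalent ::
  "real set \<Rightarrow> ('b::cstar_algebra, 'e::complex_normed_vector, 'm) hmodule_scheme
   \<Rightarrow> (real \<Rightarrow> ('e \<Rightarrow> 'e) \<Rightarrow> ('e \<Rightarrow> 'e)) \<Rightarrow> (real \<Rightarrow> ('e \<Rightarrow> 'e) \<Rightarrow> ('e \<Rightarrow> 'e)) \<Rightarrow> bool"
  where "cocycle_equivalent S E \<theta> \<theta>' \<longleftrightarrow>
    (\<exists>u :: real \<Rightarrow> 'e \<Rightarrow> 'e.
      (\<forall>t\<in>S. u t \<in> Ba E \<and> hunitary E E (u t)) \<and>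
      u 0 = id \<and>
      (\<forall>s\<in>S. \<forall>t\<in>S. u (s + t) = u s \<circ> \<theta> s (u t)) \<and>
      (\<forall>t\<in>S. \<forall>a\<in>Ba E. \<theta>' t a = u t \<circ> \<theta> t a \<circ> adj E (u t)))"


section \<open>Correspondences and interior tensor products\<close>

record ('b, 'e) corr = "('b, 'e) hmodule" +
  lact :: "'b \<Rightarrow> 'e \<Rightarrow> 'e"

locale correspondence = hilbert_module M
  for M :: "('b::cstar_algebra, 'e::complex_normed_vector, 'm) corr_scheme" +
  assumes lact_add: "x \<in> carr M \<Longrightarrow> lact M (a + b) x = lact M a x + lact M b x"
    and lact_scaleC: "x \<in> carr M \<Longrightarrow> lact M (c *\<^sub>C b) x = c *\<^sub>C lact M b x"
    and lact_mult: "x \<in> carr M \<Longrightarrow> lact M (a * b) x = lact M a (lact M b x)"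
    and lact_adjoint: "is_adjoint M M (lact M b) (lact M (star b))"
    and lact_nondegenerate: "closure (cspan {lact M b x | b x. x \<in> carr M}) = carr M"

text \<open>The algebra as a correspondence over itself.\<close>

definition trivial_corr :: "('b::cstar_algebra, 'b) corr"
  where "trivial_corr =
    \<lparr>carr = UNIV, inn = (\<lambda>a b. star a * b), ract = (\<lambda>a b. a * b), lact = (\<lambda>a b. a * b)\<rparr>"

definition bilinear_unitary ::
  "('b::cstar_algebra, 'e::complex_normed_vector, 'm) corr_scheme
   \<Rightarrow> ('b, 'f::complex_normed_vector, 'n) corr_scheme \<Rightarrow> ('e \<Rightarrow> 'f) \<Rightarrow> bool"
  where "bilinear_unitary M N u \<longleftrightarrow> hunitary M N u \<and>
    (\<forall>b. \<forall>x\<in>carr M. u (lact M b x) = lact N b (u x) \<and> u (ract M x b) = ract N (u x) b)"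

text \<open>
  \<open>T\<close> with the elementary tensors \<open>\<tau> x y\<close> (for \<open>x \<odot> y\<close>) is the interior tensor product of
  \<open>M\<close> and \<open>N\<close>: the correspondence generated by elementary tensors with the prescribed inner
  products and left action. The inner product formula forces \<open>\<tau>\<close> to be bilinear, balanced and
  compatible with the right action.
\<close>

definition interior_tensor ::
  "('b::cstar_algebra, 'e::complex_normed_vector, 'm) corr_scheme
   \<Rightarrow> ('b, 'f::complex_normed_vector, 'n) corr_scheme
   \<Rightarrow> ('b, 'g::complex_normed_vector, 'k) corr_scheme \<Rightarrow> ('e \<Rightarrow> 'f \<Rightarrow> 'g) \<Rightarrow> bool"
  where "interior_tensor M N T \<tau> \<longleftrightarrow> correspondence T \<and>
    (\<forall>x\<in>carr M. \<forall>y\<in>carr N. \<tau> x y \<in> carr T) \<and>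
    (\<forall>x\<in>carr M. \<forall>y\<in>carr N. \<forall>x'\<in>carr M. \<forall>y'\<in>carr N.
      inn T (\<tau> x y) (\<tau> x' y') = inn N y (lact N (inn M x x') y')) \<and>
    (\<forall>b. \<forall>x\<in>carr M. \<forall>y\<in>carr N. lact T b (\<tau> x y) = \<tau> (lact M b x) y) \<and>
    closure (cspan {\<tau> x y | x y. x \<in> carr M \<and> y \<in> carr N}) = carr T"


section \<open>Product systems\<close>

text \<open>
  \<open>pmult P s t x y\<close> is \<open>x\<^sub>s y\<^sub>t\<close>. Since the fibres share a type, the equality of the fibre at
  time \<open>0\<close> with the algebra is expressed by a specified identification
  \<open>pid P\<close>, which is part of the structure and is respected by isomorphisms.
\<close>

record ('b, 'p) psystem =
  fib :: "real \<Rightarrow> ('b, 'p) corr"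
  pmult :: "real \<Rightarrow> real \<Rightarrow> 'p \<Rightarrow> 'p \<Rightarrow> 'p"
  pid :: "'b \<Rightarrow> 'p"

text \<open>
  In \<open>pmult_unitary\<close> the tensor product may be taken in the type of the fibres without loss of
  generality, since it is isomorphic to the fibre at \<open>s + t\<close>.
\<close>

locale product_system =
  fixes S :: "real set"
    and P :: "('b::cstar_algebra, 'p::complex_normed_vector) psystem"
  assumes fib_correspondence: "t \<in> S \<Longrightarrow> correspondence (fib P t)"
    and pid_unitary: "bilinear_unitary trivial_corr (fib P 0) (pid P)"
    and pmult_unitary: "\<lbrakk>s \<in> S; t \<in> S\<rbrakk> \<Longrightarrow>
      \<exists>(T :: ('b, 'p) corr) \<tau> u. interior_tensor (fib P s) (fib P t) T \<tau> \<and>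
        bilinear_unitary T (fib P (s + t)) u \<and>
        (\<forall>x\<in>carr (fib P s). \<forall>y\<in>carr (fib P t). pmult P s t x y = u (\<tau> x y))"
    and pmult_assoc: "\<lbrakk>r \<in> S; s \<in> S; t \<in> S;
        x \<in> carr (fib P r); y \<in> carr (fib P s); z \<in> carr (fib P t)\<rbrakk> \<Longrightarrow>
      pmult P (r + s) t (pmult P r s x y) z = pmult P r (s + t) x (pmult P s t y z)"
    and pmult_0_left: "\<lbrakk>t \<in> S; y \<in> carr (fib P t)\<rbrakk> \<Longrightarrow> pmult P 0 t (pid P b) y = lact (fib P t) b y"
    and pmult_0_right: "\<lbrakk>t \<in> S; x \<in> carr (fib P t)\<rbrakk> \<Longrightarrow> pmult P t 0 x (pid P b) = ract (fib P t) x b"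

definition psystem_isomorphic ::
  "real set \<Rightarrow> ('b::cstar_algebra, 'p::complex_normed_vector) psystem
   \<Rightarrow> ('b, 'q::complex_normed_vector) psystem \<Rightarrow> bool"
  where "psystem_isomorphic S P Q \<longleftrightarrow>
    (\<exists>w :: real \<Rightarrow> 'p \<Rightarrow> 'q.
      (\<forall>t\<in>S. bilinear_unitary (fib P t) (fib Q t) (w t)) \<and>
      (\<forall>b. w 0 (pid P b) = pid Q b) \<and>
      (\<forall>s\<in>S. \<forall>t\<in>S. \<forall>x\<in>carr (fib P s). \<forall>y\<in>carr (fib P t).
        pmult Q s t (w s x) (w t y) = w (s + t) (pmult P s t x y)))"

text \<open>
  \<open>P\<close> is the product system associated with \<open>\<theta>\<close>; it is determined by \<open>\<theta>\<close> up to isomorphism.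
  Here \<open>j t x y\<close> is the generating element \<open>x\<^sup>* \<odot>\<^sub>t y\<close> of the fibre at \<open>t\<close>.
\<close>

definition associated_psystem ::
  "real set \<Rightarrow> ('b::cstar_algebra, 'e::complex_normed_vector, 'm) hmodule_scheme
   \<Rightarrow> (real \<Rightarrow> ('e \<Rightarrow> 'e) \<Rightarrow> ('e \<Rightarrow> 'e)) \<Rightarrow> ('b, 'p::complex_normed_vector) psystem \<Rightarrow> bool"
  where "associated_psystem S E \<theta> P \<longleftrightarrow> product_system S P \<and>
    (\<exists>j :: real \<Rightarrow> 'e \<Rightarrow> 'e \<Rightarrow> 'p.
      (\<forall>t\<in>S. closure (cspan {j t x y | x y. x \<in> carr E \<and> y \<in> carr E}) = carr (fib P t)) \<and>
      (\<forall>t\<in>S. \<forall>x\<in>carr E. \<forall>y\<in>carr E. \<forall>x'\<in>carr E. \<forall>y'\<in>carr E.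
        inn (fib P t) (j t x y) (j t x' y') = inn E y (\<theta> t (rank1 E x x') y')) \<and>
      (\<forall>t\<in>S. \<forall>x\<in>carr E. \<forall>y\<in>carr E. \<forall>b.
        ract (fib P t) (j t x y) b = j t x (ract E y b) \<and>
        lact (fib P t) b (j t x y) = j t (ract E x (star b)) y) \<and>
      (\<forall>s\<in>S. \<forall>t\<in>S. \<forall>x\<in>carr E. \<forall>x'\<in>carr E. \<forall>y\<in>carr E. \<forall>y'\<in>carr E.
        pmult P s t (j s x x') (j t y y') = j (s + t) x (\<theta> t (rank1 E x' y) y')) \<and>
      (\<forall>x\<in>carr E. \<forall>y\<in>carr E. j 0 x y = pid P (inn E x y)))"

end

theory Submission
  imports Defs
begin

text \<open>
  A product system fibre \<open>F = E\<^sub>t\<close> satisfies \<open>E \<odot> F = E\<close> via \<open>x (y\<^sup>* \<odot> z) = \<theta>\<^sub>t(x y\<^sup>*) z\<close>, the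
  adjoint of left multiplication by \<open>x\<close> being \<open>v \<mapsto> x\<^sup>* \<odot> v\<close>. A bilinear unitary \<open>w\<close> between
  fibres therefore induces the unitary \<open>u = id \<odot> w\<close> on \<open>E\<close>, and it is related to \<open>w\<close> by
  \<open>w (x\<^sup>* \<odot> y) = x\<^sup>* \<odot>' u y\<close>. Conversely, this formula defines \<open>w\<close> from \<open>u\<close>. As the maps
  \<open>y \<mapsto> x\<^sup>* \<odot> y\<close> jointly separate points, multiplicativity of the family \<open>w\<close> translates into the
  cocycle identity, and the covariance \<open>x\<^sup>* \<odot> \<theta>\<^sub>t(a) y = (a\<^sup>* x)\<^sup>* \<odot> y\<close> into
  \<open>u \<theta>\<^sub>t(a) = \<theta>'\<^sub>t(a) u\<close>.

  Strictness has to be applied to operators of rank one only, which requires that a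
  \<open>*\<close>-endomorphism of the algebra of adjointable operators is norm continuous. The order and
  spectral theory of C*-algebras is avoided here: a small self-adjoint operator is the real part of
  a unitary, and endomorphisms map unitaries to isometries.
\<close>


section \<open>Continuity of the inner product\<close>

lemma scaleC_minus_one [simp]: "(-1) *\<^sub>C x = - (x::'a::complex_vector)"
  by (simp add: complex_vector.scale_minus_left)

lemma tendsto_scaleC:
  fixes f :: "nat \<Rightarrow> 'a::complex_normed_vector"
  assumes "f \<longlonglongrightarrow> x"
  shows "(\<lambda>n. c *\<^sub>C f n) \<longlonglongrightarrow> c *\<^sub>C x"
proof -
  have "(\<lambda>n. c *\<^sub>C (f n - x)) \<longlonglongrightarrow> 0"
  proof (rule Lim_null_comparison)
    show "(\<lambda>n. cmod c * norm (f n - x)) \<longlonglongrightarrow> 0"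
      using assms by (metis LIM_zero tendsto_mult_right_zero tendsto_norm_zero)
  qed (simp add: norm_scaleC)
  then show ?thesis by (simp add: complex_vector.scale_right_diff_distrib LIM_zero_iff)
qed

text \<open>The limit case supplies \<open>P\<close> for every member of the sequence, so
  \<open>P\<close> may be an existential statement and witnesses can be chosen along the sequence,
  as in \<open>total_relation\<close>.\<close>

lemma closure_cspan_induct [consumes 1, case_names base zero add scale lim]:
  fixes D :: "'a::complex_normed_vector set"
  assumes x: "x \<in> closure (cspan D)"
    and base: "\<And>d. d \<in> D \<Longrightarrow> P d" and zero: "P 0"
    and add: "\<And>x y. P x \<Longrightarrow> P y \<Longrightarrow> P (x + y)"
    and scale: "\<And>c x. P x \<Longrightarrow> P (c *\<^sub>C x)"
    and lim: "\<And>f x. (\<And>n. P (f n)) \<Longrightarrow> f \<longlonglongrightarrow> x \<Longrightarrow> P x"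
  shows "P x"
proof -
  have *: "P y" if "y \<in> cspan D" for y
    using that by (induct rule: complex_vector.span_induct_alt) (auto intro: assms)
  obtain f where "\<And>n. f n \<in> cspan D" "f \<longlonglongrightarrow> x"
    using x by (auto simp: closure_sequential)
  then show ?thesis using lim[of f x] * by blast
qed

lemma csubspace_closure:
  fixes A :: "'a::complex_normed_vector set"
  assumes "csubspace A" shows "csubspace (closure A)"
proof (rule complex_vector.subspaceI)
  show "0 \<in> closure A"
    using assms complex_vector.subspace_0 closure_subset by blast
  fix x y assume "x \<in> closure A" "y \<in> closure A"
  then obtain f g where "\<And>n. f n \<in> A" "f \<longlonglongrightarrow> x" "\<And>n. g n \<in> A" "g \<longlonglongrightarrow> y"
    by (auto simp: closure_sequential)
  then show "x + y \<in> closure A"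
    unfolding closure_sequential using assms
    by (intro exI[of _ "\<lambda>n. f n + g n"]) (auto intro: complex_vector.subspace_add tendsto_add)
next
  fix c x assume "x \<in> closure A"
  then obtain f where "\<And>n. f n \<in> A" "f \<longlonglongrightarrow> x"
    by (auto simp: closure_sequential)
  then show "c *\<^sub>C x \<in> closure A"
    unfolding closure_sequential using assms
    by (intro exI[of _ "\<lambda>n. c *\<^sub>C f n"]) (auto intro: complex_vector.subspace_scale tendsto_scaleC)
qed

context hilbert_module
begin

lemma carr_zero [simp]: "0 \<in> carr M"
  using carr_subspace by (rule complex_vector.subspace_0)
lemma carr_add [simp]: "x \<in> carr M \<Longrightarrow> y \<in> carr M \<Longrightarrow> x + y \<in> carr M"
  using carr_subspace by (rule complex_vector.subspace_add)
lemma carr_diff [simp]: "x \<in> carr M \<Longrightarrow> y \<in> carr M \<Longrightarrow> x - y \<in> carr M"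
  using carr_subspace by (rule complex_vector.subspace_diff)
lemma carr_scaleC [simp]: "x \<in> carr M \<Longrightarrow> c *\<^sub>C x \<in> carr M"
  using carr_subspace by (rule complex_vector.subspace_scale)

lemma carr_closed: "closed (carr M)"
  by (rule complete_imp_closed[OF carr_complete])

lemma carr_lim: "(\<And>n. f n \<in> carr M) \<Longrightarrow> f \<longlonglongrightarrow> x \<Longrightarrow> x \<in> carr M"
  using carr_closed closed_sequentially by blast

lemma inn_add_left:
  assumes "x \<in> carr M" "y \<in> carr M" "z \<in> carr M"
  shows "inn M (x + y) z = inn M x z + inn M y z"
proof -
  have "inn M (x + y) z = star (inn M z (x + y))"
    using assms by (simp add: star_inn)
  also have "\<dots> = inn M x z + inn M y z"
    using assms by (simp add: inn_add_right star_add star_inn)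
  finally show ?thesis .
qed

lemma inn_scaleC_left:
  assumes "x \<in> carr M" "y \<in> carr M"
  shows "inn M (c *\<^sub>C x) y = cnj c *\<^sub>C inn M x y"
proof -
  have "inn M (c *\<^sub>C x) y = star (inn M y (c *\<^sub>C x))"
    using assms by (simp add: star_inn)
  also have "\<dots> = cnj c *\<^sub>C inn M x y"
    using assms by (simp add: inn_scaleC_right star_scaleC star_inn)
  finally show ?thesis .
qed

lemma inn_zero_right [simp]:
  assumes "x \<in> carr M" shows "inn M x 0 = 0"
  using inn_scaleC_right[OF assms carr_zero, of 0] by simp

lemma inn_zero_left [simp]:
  assumes "x \<in> carr M" shows "inn M 0 x = 0"
  using inn_scaleC_left[OF carr_zero assms, of 0] by simp

lemma inn_diff_right:
  assumes "x \<in> carr M" "y \<in> carr M" "z \<in> carr M"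
  shows "inn M x (y - z) = inn M x y - inn M x z"
  using inn_add_right[OF assms(1,2) carr_scaleC[OF assms(3)], of "-1"] inn_scaleC_right[OF assms(1,3), of "-1"]
  by simp

lemma inn_diff_left:
  assumes "x \<in> carr M" "y \<in> carr M" "z \<in> carr M"
  shows "inn M (x - y) z = inn M x z - inn M y z"
  using inn_add_left[OF assms(1) carr_scaleC[OF assms(2)] assms(3), of "-1"] inn_scaleC_left[OF assms(2,3), of "-1"]
  by simp

lemma norm_sq: "x \<in> carr M \<Longrightarrow> (norm x)\<^sup>2 = norm (inn M x x)"
  by (simp add: norm_inn)

text \<open>Polarisation; the Cauchy-Schwarz inequality, with constant 1, would need the order of the
  C*-algebra.\<close>

lemma norm_inn_le:
  assumes "x \<in> carr M" "y \<in> carr M"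
  shows "norm (inn M x y) \<le> 4 * norm x * norm y"
proof -
  have Q: "norm (inn M (x + c *\<^sub>C y) (x + c *\<^sub>C y)) \<le> (norm x + cmod c * norm y)\<^sup>2"
    if "x \<in> carr M" "y \<in> carr M" for x y c
    using that norm_triangle_ineq[of x "c *\<^sub>C y"]
    by (subst norm_sq[symmetric]) (auto simp: norm_scaleC intro!: power_mono)
  have pol: "4 *\<^sub>C inn M x y = (inn M (x + 1 *\<^sub>C y) (x + 1 *\<^sub>C y) - inn M (x + (-1) *\<^sub>C y) (x + (-1) *\<^sub>C y))
      + (-\<i>) *\<^sub>C (inn M (x + \<i> *\<^sub>C y) (x + \<i> *\<^sub>C y) - inn M (x + (-\<i>) *\<^sub>C y) (x + (-\<i>) *\<^sub>C y))"
    if "x \<in> carr M" "y \<in> carr M" for x y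
  proof -
    have four: "4 *\<^sub>C z = z + z + z + z" for z :: 'b
      using scaleC_add_left[of 2 2 z] scaleC_add_left[of 1 1 z] by simp
    have *: "inn M (x + c *\<^sub>C y) (x + c *\<^sub>C y) = inn M x x + c *\<^sub>C inn M x y + cnj c *\<^sub>C inn M y x
        + (cnj c * c) *\<^sub>C inn M y y" for c
      using that by (simp add: inn_add_left inn_add_right inn_scaleC_left inn_scaleC_right
          scaleC_add_right scaleC_scaleC algebra_simps)
    show ?thesis unfolding *
      by (simp add: four complex_vector.scale_right_diff_distrib scaleC_add_right scaleC_scaleC
          complex_vector.scale_minus_left)
  qed
  \<comment> \<open>For unit vectors each of the four quadratic terms has norm at most (1 + 1)^2 =
    4, so the polarisation sum is at most 16 and a quarter of it at most 4. Homogeneity extends this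
    to all vectors.\<close>
  have unit: "norm (inn M x y) \<le> 4" if "x \<in> carr M" "y \<in> carr M" "norm x = 1" "norm y = 1" for x y
  proof -
    have b: "norm (inn M (x + c *\<^sub>C y) (x + c *\<^sub>C y)) \<le> 4" if "cmod c = 1" for c
      using Q[of x y c] that \<open>norm x = 1\<close> \<open>norm y = 1\<close> \<open>x \<in> carr M\<close> \<open>y \<in> carr M\<close> by simp
    have tri: "norm ((p - q) + (-\<i>) *\<^sub>C (r - s)) \<le> (norm p + norm q) + (norm r + norm s)" for p q r s :: 'b
      using norm_triangle_ineq[of "p - q" "(-\<i>) *\<^sub>C (r - s)"] norm_triangle_ineq4[of p q]
        norm_triangle_ineq4[of r s] norm_scaleC[of "-\<i>" "r - s"] by simp
    have "4 * norm (inn M x y) = norm (4 *\<^sub>C inn M x y)"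
      by (simp add: norm_scaleC)
    also have "\<dots> \<le> (4 + 4) + (4 + 4)"
      unfolding pol[OF that(1,2)]
      by (rule order.trans[OF tri]) (intro add_mono b, simp_all)
    finally show ?thesis by simp
  qed
  show ?thesis
  proof (cases "x = 0 \<or> y = 0")
    case True
    then show ?thesis using assms by auto
  next
    case False
    define x' y' where "x' = complex_of_real (inverse (norm x)) *\<^sub>C x"
      and "y' = complex_of_real (inverse (norm y)) *\<^sub>C y"
    have "norm (inn M x' y') \<le> 4"
      using False assms by (intro unit) (auto simp: x'_def y'_def norm_scaleC norm_inverse)
    moreover have "inn M x' y' = complex_of_real (inverse (norm x) * inverse (norm y)) *\<^sub>C inn M x y"
      using assms by (simp add: x'_def y'_def inn_scaleC_left inn_scaleC_right scaleC_scaleC)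
    ultimately show ?thesis
      using False by (simp add: norm_scaleC norm_mult norm_divide norm_inverse field_simps)
  qed
qed

lemma tendsto_inn:
  assumes "\<And>n. f n \<in> carr M" "f \<longlonglongrightarrow> x" "\<And>n. g n \<in> carr M" "g \<longlonglongrightarrow> y"
  shows "(\<lambda>n. inn M (f n) (g n)) \<longlonglongrightarrow> inn M x y"
proof -
  have x: "x \<in> carr M" "y \<in> carr M" using carr_lim assms by blast+
  have "(\<lambda>n. inn M (f n) (g n) - inn M x y) \<longlonglongrightarrow> 0"
  proof (rule Lim_null_comparison)
    show "(\<lambda>n. 4 * norm (f n) * norm (g n - y) + 4 * norm (f n - x) * norm y) \<longlonglongrightarrow> 0"
    proof -
      have "(\<lambda>n. 4 * norm (f n) * norm (g n - y) + 4 * norm (f n - x) * norm y)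
          \<longlonglongrightarrow> 4 * norm x * norm (y - y) + 4 * norm (x - x) * norm y"
        by (intro tendsto_intros assms)
      then show ?thesis by simp
    qed
    show "\<forall>\<^sub>F n in sequentially. norm (inn M (f n) (g n) - inn M x y)
        \<le> 4 * norm (f n) * norm (g n - y) + 4 * norm (f n - x) * norm y"
    proof (rule always_eventually, rule allI)
      fix n
      have "inn M (f n) (g n) - inn M x y = inn M (f n) (g n - y) + inn M (f n - x) y"
        using assms x by (simp add: inn_diff_left inn_diff_right)
      also have "norm \<dots> \<le> 4 * norm (f n) * norm (g n - y) + 4 * norm (f n - x) * norm y"
        using assms x by (intro order.trans[OF norm_triangle_ineq] add_mono norm_inn_le) auto
      finally show "norm (inn M (f n) (g n) - inn M x y)
        \<le> 4 * norm (f n) * norm (g n - y) + 4 * norm (f n - x) * norm y" .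
    qed
  qed
  then show ?thesis by (simp add: LIM_zero_iff)
qed

text \<open>The vectors orthogonal to \<open>x - y\<close> form a closed subspace. It contains
  \<open>D\<close>, hence the whole carrier, hence \<open>x - y\<close> itself.\<close>

lemma inn_eqI:
  assumes x: "x \<in> carr M" "y \<in> carr M" and D: "closure (cspan D) = carr M"
    and eq: "\<And>z. z \<in> D \<Longrightarrow> inn M z x = inn M z y"
  shows "x = y"
proof -
  have D': "D \<subseteq> carr M"
    using complex_vector.span_superset[of D] closure_subset D by blast
  have "z \<in> carr M \<and> inn M z (x - y) = 0" if "z \<in> closure (cspan D)" for z
    using that
  proof (induct rule: closure_cspan_induct)
    case (lim f z)
    then have "(\<lambda>n. inn M (f n) (x - y)) \<longlonglongrightarrow> inn M z (x - y)"
      using x by (intro tendsto_inn) auto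
    moreover have "(\<lambda>n. inn M (f n) (x - y)) = (\<lambda>n. 0)"
      using lim by auto
    ultimately show ?case
      using lim by (auto intro: carr_lim simp: LIMSEQ_const_iff)
  qed (use x D' eq in \<open>auto simp: inn_add_left inn_scaleC_left inn_diff_right\<close>)
  then have "inn M (x - y) (x - y) = 0"
    using x D by auto
  then show ?thesis using x inn_definite[of "x - y"] by simp
qed

lemma inn_eqI':
  assumes x: "x \<in> carr M" and y: "y \<in> carr M"
    and eq: "\<And>z. z \<in> carr M \<Longrightarrow> inn M z x = inn M z y"
  shows "x = y"
proof (rule inn_eqI[OF x y _ eq])
  show "closure (cspan (carr M)) = carr M"
    by (simp only: complex_vector.span_eq_iff[THEN iffD2, OF carr_subspace] closure_closed[OF carr_closed])
qed

lemma inn_eqI_left: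
  assumes x: "x \<in> carr M" and y: "y \<in> carr M"
    and eq: "\<And>z. z \<in> carr M \<Longrightarrow> inn M x z = inn M y z"
  shows "x = y"
proof (rule inn_eqI'[OF x y])
  fix z assume z: "z \<in> carr M"
  have "inn M z x = star (inn M x z)" by (rule star_inn[OF x z, symmetric])
  also have "\<dots> = inn M z y" by (simp only: eq[OF z] star_inn[OF y z])
  finally show "inn M z x = inn M z y" .
qed

text \<open>Extension by continuity, phrased for relations so that well-definedness on the span need
  not be checked first. Values chosen along a convergent sequence form a Cauchy sequence by
  \<open>bound\<close>, applied to differences, and \<open>lim\<close> makes their limit a value. It
  serves to construct maps that are described by inner products.\<close>

lemma total_relation:
  assumes N: "hilbert_module N" and D: "closure (cspan D) = carr M"
    and dom: "\<And>x y. R x y \<Longrightarrow> x \<in> carr M \<and> y \<in> carr N"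
    and base: "\<And>d. d \<in> D \<Longrightarrow> \<exists>y. R d y"
    and add: "\<And>x y x' y'. R x y \<Longrightarrow> R x' y' \<Longrightarrow> R (x + x') (y + y')"
    and scale: "\<And>c x y. R x y \<Longrightarrow> R (c *\<^sub>C x) (c *\<^sub>C y)"
    and bound: "\<And>x y. R x y \<Longrightarrow> norm y \<le> C * norm x"
    and lim: "\<And>f g x y. (\<And>n. R (f n) (g n)) \<Longrightarrow> f \<longlonglongrightarrow> x \<Longrightarrow> g \<longlonglongrightarrow> y \<Longrightarrow> R x y"
    and zero: "R 0 0"
    and x: "x \<in> carr M"
  shows "\<exists>y. R x y"
proof -
  interpret N: hilbert_module N by (rule N)
  have "x \<in> closure (cspan D)" using x D by simp
  then show ?thesis
  proof (induct rule: closure_cspan_induct)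
    case (lim f x)
    then obtain g where g: "\<And>n. R (f n) (g n)" by metis
    have diff: "R (f m - f n) (g m - g n)" for m n
      using add[OF g[of m] scale[OF g[of n], of "-1"]] by simp
    have "Cauchy g"
    proof (rule CauchyI)
      fix e :: real assume "e > 0"
      \<comment> \<open>No sign of \<open>C\<close> is assumed, so the division below uses a
        constant that is certainly positive.\<close>
      have C: "0 < \<bar>C\<bar> + 1" by simp
      obtain n0 where n0: "\<forall>m\<ge>n0. \<forall>n\<ge>n0. norm (f m - f n) < e / (\<bar>C\<bar> + 1)"
        using CauchyD[OF LIMSEQ_imp_Cauchy[OF lim(2)], of "e / (\<bar>C\<bar> + 1)"] \<open>e > 0\<close> C by auto
      show "\<exists>M. \<forall>m\<ge>M. \<forall>n\<ge>M. norm (g m - g n) < e"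
      proof (intro exI allI impI)
        fix m n assume "m \<ge> n0" "n \<ge> n0"
        have "norm (g m - g n) \<le> C * norm (f m - f n)" by (rule bound[OF diff])
        also have "\<dots> \<le> (\<bar>C\<bar> + 1) * norm (f m - f n)" by (intro mult_right_mono) auto
        also have "\<dots> < e"
          using n0 \<open>m \<ge> n0\<close> \<open>n \<ge> n0\<close> C by (simp add: field_simps)
        finally show "norm (g m - g n) < e" .
      qed
    qed
    then obtain y where "g \<longlonglongrightarrow> y"
      using N.carr_complete dom[OF g] unfolding complete_def by blast
    then have "R x y" by (rule assms(8)[OF g lim(2)])
    then show ?case ..
  next
    case (base d) then show ?case by (rule assms(4))
  next
    case zero then show ?case using assms(9) ..
  next
    case (add x x')
    then obtain y y' where "R x y" "R x' y'" by blast
    then have "R (x + x') (y + y')" by (rule assms(5))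
    then show ?case ..
  next
    case (scale c x)
    then obtain y where "R x y" by blast
    then have "R (c *\<^sub>C x) (c *\<^sub>C y)" by (rule assms(6))
    then show ?case ..
  qed
qed

end


section \<open>Adjointable maps\<close>

locale hilbert_pair = M: hilbert_module M + N: hilbert_module N
  for M :: "('b::cstar_algebra, 'e::complex_normed_vector, 'm) hmodule_scheme"
    and N :: "('b, 'f::complex_normed_vector, 'n) hmodule_scheme"
begin

lemma is_adjoint_sym:
  assumes "is_adjoint M N a a'" shows "is_adjoint N M a' a"
  unfolding is_adjoint_def
proof (intro conjI ballI)
  fix y x assume y: "y \<in> carr N" and x: "x \<in> carr M"
  have c: "a x \<in> carr N" "a' y \<in> carr M" "inn N (a x) y = inn M x (a' y)"
    using assms x y by (auto simp: is_adjoint_def)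
  have "inn M (a' y) x = star (inn M x (a' y))"
    by (rule M.star_inn[OF x c(2), symmetric])
  also have "\<dots> = inn N y (a x)"
    by (simp only: c(3)[symmetric] N.star_inn[OF c(1) y])
  finally show "inn M (a' y) x = inn N y (a x)" .
qed (use assms in \<open>auto simp: is_adjoint_def\<close>)

context
  fixes a a' assumes adj: "is_adjoint M N a a'"
begin

lemma adjoint_closed: "x \<in> carr M \<Longrightarrow> a x \<in> carr N"
  and adjoint_closed': "y \<in> carr N \<Longrightarrow> a' y \<in> carr M"
  and adjoint_inn: "x \<in> carr M \<Longrightarrow> y \<in> carr N \<Longrightarrow> inn N (a x) y = inn M x (a' y)"
  using adj by (auto simp: is_adjoint_def)

lemma adjoint_inn': "x \<in> carr M \<Longrightarrow> y \<in> carr N \<Longrightarrow> inn N y (a x) = inn M (a' y) x"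
  using is_adjoint_sym[OF adj] by (auto simp: is_adjoint_def)

text \<open>Having an adjoint forces linearity, here and in the next two lemmas: both sides have the
  same inner products with every vector of the target module.\<close>

lemma adjoint_add: "x \<in> carr M \<Longrightarrow> y \<in> carr M \<Longrightarrow> a (x + y) = a x + a y"
  by (rule N.inn_eqI') (auto simp: adjoint_closed adjoint_closed' adjoint_inn' N.inn_add_right M.inn_add_right)

lemma adjoint_scaleC: "x \<in> carr M \<Longrightarrow> a (c *\<^sub>C x) = c *\<^sub>C a x"
  by (rule N.inn_eqI') (auto simp: adjoint_closed adjoint_closed' adjoint_inn' N.inn_scaleC_right M.inn_scaleC_right)

lemma adjoint_ract: "x \<in> carr M \<Longrightarrow> a (ract M x b) = ract N (a x) b"
  by (rule N.inn_eqI') (auto simp: adjoint_closed adjoint_closed' adjoint_inn' N.inn_ract_right M.inn_ract_right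
      M.ract_closed N.ract_closed)

lemma adjoint_zero: "a 0 = 0"
  using adjoint_scaleC[OF M.carr_zero, of 0] by simp

end

text \<open>Adjointable maps are weakly continuous, so no boundedness is needed here.\<close>

lemma adjointable_eq_on_closure:
  assumes a: "is_adjoint M N a a'" and b: "is_adjoint M N b b'"
    and D: "closure (cspan D) = carr M" and eq: "\<And>d. d \<in> D \<Longrightarrow> a d = b d"
    and x: "x \<in> carr M"
  shows "a x = b x"
proof (rule N.inn_eqI')
  fix y assume y: "y \<in> carr N"
  have D': "D \<subseteq> carr M"
    using complex_vector.span_superset[of D] closure_subset D by blast
  have "a' y = b' y"
  proof (rule M.inn_eqI[OF _ _ D])
    fix z assume z: "z \<in> D"
    then show "inn M z (a' y) = inn M z (b' y)"
      using y D' adjoint_inn[OF a, of z y] adjoint_inn[OF b, of z y] by (auto simp: eq)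
  qed (use y adjoint_closed' a b in blast)+
  then show "inn N y (a x) = inn N y (b x)"
    using adjoint_inn'[OF a x y] adjoint_inn'[OF b x y] by simp
qed (use x adjoint_closed a b in blast)+

lemma hunitaryE:
  assumes "hunitary M N u"
  obtains u' where "is_adjoint M N u u'" "\<And>x. x \<in> carr M \<Longrightarrow> u' (u x) = x" "\<And>y. y \<in> carr N \<Longrightarrow> u (u' y) = y"
  using assms by (auto simp: hunitary_def)

lemma hunitary_inn:
  assumes "hunitary M N u" "x \<in> carr M" "y \<in> carr M"
  shows "inn N (u x) (u y) = inn M x y"
proof -
  obtain u' where u': "is_adjoint M N u u'" "\<And>x. x \<in> carr M \<Longrightarrow> u' (u x) = x"
    using hunitaryE[OF assms(1)] by metis
  show ?thesis
    using adjoint_inn[OF u'(1) assms(2) adjoint_closed[OF u'(1) assms(3)]] u'(2)[OF assms(3)] by simp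
qed

lemma hunitary_closed:
  assumes "hunitary M N u" "x \<in> carr M" shows "u x \<in> carr N"
  using assms by (auto simp: hunitary_def is_adjoint_def)

lemma hunitary_surj:
  assumes "hunitary M N u" "y \<in> carr N" shows "\<exists>x\<in>carr M. u x = y"
  using assms by (auto simp: hunitary_def is_adjoint_def)

end

lemma is_adjoint_comp:
  assumes "is_adjoint M N a a'" "is_adjoint N K b b'"
  shows "is_adjoint M K (b \<circ> a) (a' \<circ> b')"
  using assms unfolding is_adjoint_def by simp

section \<open>Operators on a module that exhausts its type\<close>

locale hilbert_type = hilbert_module E
  for E :: "('b::cstar_algebra, 'e::complex_normed_vector, 'm) hmodule_scheme" +
  assumes carr_UNIV [simp]: "carr E = UNIV"
begin

sublocale EE: hilbert_pair E E ..

lemma is_adjoint_iff: "is_adjoint E E a b \<longleftrightarrow> (\<forall>x y. inn E (a x) y = inn E x (b y))"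
  by (simp add: is_adjoint_def)

lemmas E_simps = inn_add_left[simplified] inn_add_right[simplified] inn_scaleC_left[simplified]
  inn_scaleC_right[simplified] inn_diff_left[simplified] inn_diff_right[simplified]
  inn_ract_right[simplified]

lemma adjoint_E: "is_adjoint E E a b \<Longrightarrow> inn E (a x) y = inn E x (b y)"
  by (simp add: is_adjoint_iff)

lemma adjoint_unique: "is_adjoint E E a b \<Longrightarrow> is_adjoint E E a c \<Longrightarrow> b = c"
  by (rule ext, rule inn_eqI') (auto simp: is_adjoint_iff)

lemma adj_eq: "is_adjoint E E a b \<Longrightarrow> adj E a = b"
  unfolding adj_def using adjoint_unique by blast

lemma Ba_adj: "a \<in> Ba E \<Longrightarrow> is_adjoint E E a (adj E a)"
  using adj_eq by (auto simp: Ba_def)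

lemma BaI: "is_adjoint E E a b \<Longrightarrow> a \<in> Ba E"
  by (auto simp: Ba_def)

lemma is_adjoint_add: "is_adjoint E E a a' \<Longrightarrow> is_adjoint E E b b' \<Longrightarrow>
    is_adjoint E E (\<lambda>x. a x + b x) (\<lambda>x. a' x + b' x)"
  by (simp add: is_adjoint_iff E_simps)

lemma is_adjoint_scale: "is_adjoint E E a a' \<Longrightarrow>
    is_adjoint E E (\<lambda>x. c *\<^sub>C a x) (\<lambda>x. cnj c *\<^sub>C a' x)"
  by (simp add: is_adjoint_iff E_simps)

lemma is_adjoint_id: "is_adjoint E E id id"
  by (simp add: is_adjoint_iff)

lemma is_adjoint_rank1: "is_adjoint E E (rank1 E x y) (rank1 E y x)"
  unfolding is_adjoint_iff
proof (intro allI)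
  fix u v
  have "inn E (rank1 E x y u) v = star (inn E v (rank1 E x y u))"
    by (simp add: star_inn)
  also have "\<dots> = inn E u (rank1 E y x v)"
    by (simp add: rank1_def E_simps star_mult star_inn)
  finally show "inn E (rank1 E x y u) v = inn E u (rank1 E y x v)" .
qed

lemma tendsto_inn_right: "f \<longlonglongrightarrow> y \<Longrightarrow> (\<lambda>n. inn E x (f n)) \<longlonglongrightarrow> inn E x y"
  by (rule tendsto_inn) auto

text \<open>Uniform boundedness by Baire category. The sets \<open>A n\<close> are closed because
  \<open>inn E z (a y)\<close> equals \<open>inn E (b z) y\<close>, which is continuous in
  \<open>y\<close>, and they cover the complete module. So one of them contains a ball, on which
  \<open>a\<close> is weakly bounded. Testing against the normalised vector \<open>a x\<close> turns
  the weak bound into a norm bound.\<close>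

lemma adjointable_bounded:
  assumes a: "is_adjoint E E a b"
  obtains C where "C \<ge> 0" "\<And>x. norm (a x) \<le> C * norm x"
proof -
  define A where "A n = {y. \<forall>z. norm z \<le> 1 \<longrightarrow> norm (inn E z (a y)) \<le> real n}" for n
  have cl: "closed (A n)" for n
    unfolding closed_sequential_limits
  proof (intro allI impI, elim conjE)
    fix f y assume f: "\<forall>k. f k \<in> A n" and lim: "f \<longlonglongrightarrow> y"
    have "norm (inn E z (a y)) \<le> real n" if "norm z \<le> 1" for z
    proof (rule LIMSEQ_le_const2)
      show "(\<lambda>k. norm (inn E (b z) (f k))) \<longlonglongrightarrow> norm (inn E z (a y))"
        unfolding EE.adjoint_inn'[OF a, simplified] by (intro tendsto_norm tendsto_inn_right lim)
      show "\<exists>N. \<forall>k\<ge>N. norm (inn E (b z) (f k)) \<le> real n"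
        using f that EE.adjoint_inn'[OF a] by (auto simp: A_def)
    qed
    then show "y \<in> A n" by (simp add: A_def)
  qed
  have "y \<in> \<Union>(range A)" for y
  proof -
    obtain n where n: "4 * norm (a y) \<le> real n" using real_arch_simple by blast
    have "norm (inn E z (a y)) \<le> real n" if "norm z \<le> 1" for z
    proof -
      have "norm (inn E z (a y)) \<le> 4 * norm z * norm (a y)" by (rule norm_inn_le) auto
      also have "\<dots> \<le> 4 * norm (a y)" using that by (simp add: mult_left_le_one_le)
      finally show ?thesis using n by simp
    qed
    then show ?thesis by (auto simp: A_def)
  qed
  then have un: "\<Union>(range A) = UNIV" by blast
  have "\<exists>n. interior (A n) \<noteq> {}"
  proof (rule ccontr)
    assume "\<not> ?thesis"
    then have "interior (\<Union>(range A)) = {}"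
      using Met_TC.metric_Baire_category_alt[of "range A"] carr_complete cl
      by (auto simp: mcomplete_iff_complete)
    then show False by (simp add: un)
  qed
  then obtain n y0 where "y0 \<in> interior (A n)" by auto
  then obtain e where e: "e > 0" "ball y0 e \<subseteq> A n"
    by (auto simp: mem_interior)
  have main: "norm (inn E z (a x)) \<le> 4 * real n / e * norm x" if z: "norm z \<le> 1" for x z
  proof (cases "x = 0")
    case True
    then show ?thesis using EE.adjoint_zero[OF a] by simp
  next
    case False
    \<comment> \<open>This factor scales \<open>x\<close> to length e / 2, so that adding it to
      \<open>y0\<close> stays inside the ball. The values at the two points differ by at most 2 n,
      and dividing by \<open>r\<close> gives the constant 4 n / e.\<close>
    define r where "r = e / (2 * norm x)"
    have r: "r > 0" using e False by (simp add: r_def)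
    have "norm (complex_of_real r *\<^sub>C x) = e / 2"
      unfolding norm_scaleC norm_of_real using e(1) False by (simp add: r_def)
    then have "y0 + complex_of_real r *\<^sub>C x \<in> ball y0 e"
      using e by (simp add: dist_norm)
    then have 1: "norm (inn E z (a (y0 + complex_of_real r *\<^sub>C x))) \<le> real n"
      using e z unfolding A_def by blast
    have 2: "norm (inn E z (a y0)) \<le> real n"
      using e z unfolding A_def by (metis (mono_tags, lifting) centre_in_ball mem_Collect_eq subsetD)
    have "inn E z (a (y0 + complex_of_real r *\<^sub>C x)) = inn E z (a y0) + complex_of_real r *\<^sub>C inn E z (a x)"
      by (simp add: EE.adjoint_add[OF a] EE.adjoint_scaleC[OF a] E_simps)
    then have "complex_of_real r *\<^sub>C inn E z (a x)
        = inn E z (a (y0 + complex_of_real r *\<^sub>C x)) - inn E z (a y0)" by simp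
    then have "norm (complex_of_real r *\<^sub>C inn E z (a x)) \<le> 2 * real n"
      using norm_triangle_ineq4[of "inn E z (a (y0 + complex_of_real r *\<^sub>C x))" "inn E z (a y0)"] 1 2 by simp
    then show ?thesis
      unfolding norm_scaleC norm_of_real using r e False by (simp add: r_def field_simps)
  qed
  show ?thesis
  proof (rule that[of "4 * real n / e"])
    show "0 \<le> 4 * real n / e" using e by simp
    fix x
    show "norm (a x) \<le> 4 * real n / e * norm x"
    proof (cases "a x = 0")
      case True
      then show ?thesis using e by simp
    next
      case False
      define z where "z = complex_of_real (inverse (norm (a x))) *\<^sub>C a x"
      have "norm z \<le> 1" using False by (simp add: z_def norm_scaleC norm_inverse)
      moreover have "norm (inn E z (a x)) = norm (a x)"
        using False norm_sq[of "a x"]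
        by (simp add: z_def E_simps norm_scaleC norm_inverse power2_eq_square flip: norm_sq)
      ultimately show ?thesis using main[of z x] by simp
    qed
  qed
qed

lemma adjointable_bounded_linear:
  assumes a: "is_adjoint E E a b"
  shows "bounded_linear a"
proof -
  obtain C where C: "\<And>x. norm (a x) \<le> C * norm x" using adjointable_bounded[OF a] by metis
  show ?thesis
  proof (rule bounded_linear_intro[of _ C])
    show "a (x + y) = a x + a y" for x y by (simp add: EE.adjoint_add[OF a])
    show "a (r *\<^sub>R x) = r *\<^sub>R a x" for r x
      using EE.adjoint_scaleC[OF a, of x "complex_of_real r"] by (simp add: scaleC_of_real)
    show "norm (a x) \<le> norm x * C" for x using C[of x] by (simp add: mult.commute)
  qed
qed

lemma tendsto_adjointable:
  assumes "is_adjoint E E a b" "f \<longlonglongrightarrow> x" shows "(\<lambda>n. a (f n)) \<longlonglongrightarrow> a x"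
  using bounded_linear.tendsto[OF adjointable_bounded_linear] assms by blast

end


section \<open>Self-adjoint operators as real parts of unitaries\<close>

lemma geometric_steps_converge:
  fixes f :: "nat \<Rightarrow> 'a::real_normed_vector"
  assumes cpl: "complete (UNIV :: 'a set)"
    and step: "\<And>n. norm (f (Suc n) - f n) \<le> K * (1/2)^n"
  shows "\<exists>l. f \<longlonglongrightarrow> l"
proof -
  \<comment> \<open>The right-hand side is the exact sum of the geometric steps from n to n + k; the
    subtracted term is what makes the induction close.\<close>
  have tail: "norm (f (n + k) - f n) \<le> 2 * K * (1/2)^n - 2 * K * (1/2)^(n + k)" for n k
  proof (induct k)
    case (Suc k)
    have "norm (f (n + Suc k) - f n) \<le> norm (f (Suc (n + k)) - f (n + k)) + norm (f (n + k) - f n)"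
      using norm_triangle_ineq[of "f (Suc (n + k)) - f (n + k)" "f (n + k) - f n"] by simp
    also have "\<dots> \<le> K * (1/2)^(n + k) + (2 * K * (1/2)^n - 2 * K * (1/2)^(n + k))"
      by (intro add_mono step Suc)
    also have "\<dots> = 2 * K * (1/2)^n - 2 * K * (1/2)^(n + Suc k)"
      by simp
    finally show ?case .
  qed simp
  have K: "K \<ge> 0" using step[of 0] by (metis mult_1_right norm_ge_zero order.trans power_0)
  have bound: "norm (f m - f n) \<le> 2 * K * (1/2)^n" if "m \<ge> n" for m n
  proof -
    have "norm (f m - f n) \<le> 2 * K * (1/2)^n - 2 * K * (1/2)^m"
      using tail[of n "m - n"] that by simp
    also have "\<dots> \<le> 2 * K * (1/2)^n" using K by simp
    finally show ?thesis .
  qed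
  have "Cauchy f"
  proof (rule CauchyI')
    fix e :: real assume "e > 0"
    have "(\<lambda>n. 2 * K * (1/2)^n) \<longlonglongrightarrow> 2 * K * 0"
      by (intro tendsto_intros LIMSEQ_power_zero) simp
    then obtain N where "\<And>n. n \<ge> N \<Longrightarrow> 2 * K * (1/2)^n < e"
      using \<open>e > 0\<close> order_tendstoD(2)[of _ "2 * K * 0" sequentially e]
      by (auto simp: eventually_sequentially)
    then have "dist (f m) (f n) < e" if "m \<ge> N" "n > m" for m n
      using that bound[of m n] by (fastforce simp: dist_norm norm_minus_commute)
    then show "\<exists>M. \<forall>m\<ge>M. \<forall>n>m. dist (f m) (f n) < e" by blast
  qed
  then show ?thesis using cpl unfolding complete_def by blast
qed

context hilbert_type
begin

text \<open>The iteration converges to \<open>1 - sqrt (1 - T)\<close>.\<close>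

fun sqrt_approx :: "('e \<Rightarrow> 'e) \<Rightarrow> nat \<Rightarrow> 'e \<Rightarrow> 'e" where
  "sqrt_approx T 0 = (\<lambda>x. 0)"
| "sqrt_approx T (Suc n) = (\<lambda>x. (1/2) *\<^sub>C (T x + sqrt_approx T n (sqrt_approx T n x)))"

text \<open>The equation for \<open>y\<close> says (1 - y)^2 = 1 - T. The bound 1/4 on
  \<open>T\<close> keeps all iterates below norm 1/2, where the map taking y to (T + y^2) / 2
  contracts by the factor 1/2. Self-adjointness and commutation with \<open>h\<close> hold for every
  iterate and survive the limit.\<close>

lemma one_minus_sqrt:
  assumes T: "is_adjoint E E T T" and T_norm: "\<And>x. norm (T x) \<le> 1/4 * norm x"
    and h: "is_adjoint E E h h" and hT: "\<And>x. h (T x) = T (h x)"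
  obtains y where "is_adjoint E E y y" "\<And>x. y (y x) = 2 *\<^sub>C y x - T x" "\<And>x. y (h x) = h (y x)"
proof -
  let ?y = "sqrt_approx T"
  have sa: "is_adjoint E E (?y n) (?y n)" for n
  proof (induct n)
    case 0 show ?case by (simp add: is_adjoint_iff)
  next
    case (Suc n)
    show ?case
      using is_adjoint_scale[OF is_adjoint_add[OF T is_adjoint_comp[OF Suc Suc]], of "1/2"]
      by (simp add: o_def)
  qed
  have half: "norm (?y n x) \<le> 1/2 * norm x" for n x
  proof (induct n arbitrary: x)
    case (Suc n)
    have "norm (?y n (?y n x)) \<le> 1/2 * (1/2 * norm x)"
      by (rule order.trans[OF Suc]) (use Suc[of x] in simp)
    then have "norm (T x + ?y n (?y n x)) \<le> 1/2 * norm x"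
      using norm_triangle_ineq[of "T x" "?y n (?y n x)"] T_norm[of x] by linarith
    moreover have "norm x \<ge> 0" by simp
    ultimately show ?case by (simp add: norm_scaleC norm_divide del: norm_ge_zero)
  qed simp
  have step: "norm (?y (Suc n) x - ?y n x) \<le> norm x * (1/2)^n" for n x
  proof (induct n arbitrary: x)
    case 0
    have "norm (T x) \<le> 2 * norm x" using T_norm[of x] norm_ge_zero[of x] by linarith
    then show ?case by (simp add: norm_scaleC norm_divide)
  next
    case (Suc n)
    let ?a = "?y (Suc n)" and ?b = "?y n"
    \<comment> \<open>The splitting a^2 - b^2 = a (a - b) + (a - b) b, valid without commutation of
      the iterates. Each summand gains a factor 1/2 from the bound \<open>half\<close>.\<close>
    have eq: "?y (Suc (Suc n)) x - ?y (Suc n) x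
        = (1/2) *\<^sub>C (?a (?a x - ?b x) + (?a (?b x) - ?b (?b x)))"
    proof -
      have "?y (Suc (Suc n)) x - ?y (Suc n) x
          = (1/2) *\<^sub>C (T x + ?a (?a x)) - (1/2) *\<^sub>C (T x + ?b (?b x))" by (simp only: sqrt_approx.simps)
      also have "\<dots> = (1/2) *\<^sub>C (?a (?a x) - ?b (?b x))"
        by (simp add: scaleC_add_right complex_vector.scale_right_diff_distrib)
      also have "?a (?a x) - ?b (?b x) = ?a (?a x - ?b x) + (?a (?b x) - ?b (?b x))"
        using EE.adjoint_add[OF sa[of "Suc n"], of "?a x - ?b x" "?b x"] by (simp del: sqrt_approx.simps)
      finally show ?thesis .
    qed
    have 1: "norm (?a (?a x - ?b x)) \<le> 1/2 * (norm x * (1/2)^n)"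
      by (rule order.trans[OF half]) (use Suc[of x] in simp)
    have "norm (?a (?b x) - ?b (?b x)) \<le> norm (?b x) * (1/2)^n" by (rule Suc)
    also have "\<dots> \<le> (1/2 * norm x) * (1/2)^n" by (intro mult_right_mono half) simp
    finally have "norm (?a (?a x - ?b x) + (?a (?b x) - ?b (?b x))) \<le> norm x * (1/2)^n"
      using 1 norm_triangle_ineq[of "?a (?a x - ?b x)" "?a (?b x) - ?b (?b x)"] by linarith
    then show ?case unfolding eq by (simp add: norm_scaleC norm_divide del: sqrt_approx.simps)
  qed
  have "\<exists>l. (\<lambda>n. ?y n x) \<longlonglongrightarrow> l" for x
    using carr_complete by (intro geometric_steps_converge[OF _ step]) simp
  then obtain y where y: "\<And>x. (\<lambda>n. ?y n x) \<longlonglongrightarrow> y x" by metis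
  have y_sa: "is_adjoint E E y y"
    unfolding is_adjoint_iff
  proof (intro allI)
    fix u v
    have "(\<lambda>n. inn E (?y n u) v) \<longlonglongrightarrow> inn E (y u) v"
      by (rule tendsto_inn) (auto intro: y)
    moreover have "(\<lambda>n. inn E u (?y n v)) \<longlonglongrightarrow> inn E u (y v)"
      by (intro tendsto_inn_right y)
    moreover have "inn E (?y n u) v = inn E u (?y n v)" for n by (rule adjoint_E[OF sa])
    ultimately show "inn E (y u) v = inn E u (y v)" by (simp add: LIMSEQ_unique)
  qed
  have yy: "(\<lambda>n. ?y n (?y n x)) \<longlonglongrightarrow> y (y x)" for x
  proof -
    \<comment> \<open>The uniform bound on the iterates controls the error of replacing the moving
      argument \<open>?y n x\<close> by its limit \<open>y x\<close>.\<close>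
    have "(\<lambda>n. ?y n (?y n x - y x)) \<longlonglongrightarrow> 0"
    proof (rule Lim_null_comparison)
      show "(\<lambda>n. 1/2 * norm (?y n x - y x)) \<longlonglongrightarrow> 0"
        using tendsto_mult_right_zero[OF tendsto_norm_zero[OF LIM_zero[OF y[of x]]]] by blast
    qed (simp add: half[simplified])
    moreover have "?y n (?y n x - y x) = ?y n (?y n x) - ?y n (y x)" for n
      using EE.adjoint_add[OF sa[of n], of "?y n x - y x" "y x"] by simp
    ultimately have "(\<lambda>n. (?y n (?y n x) - ?y n (y x)) + ?y n (y x)) \<longlonglongrightarrow> 0 + y (y x)"
      by (intro tendsto_add y) simp
    then show ?thesis by simp
  qed
  have y_fix: "y (y x) = 2 *\<^sub>C y x - T x" for x
  proof -
    have "(\<lambda>n. ?y (Suc n) x) \<longlonglongrightarrow> (1/2) *\<^sub>C (T x + y (y x))"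
      by (simp, intro tendsto_scaleC tendsto_add tendsto_const yy)
    then have "y x = (1/2) *\<^sub>C (T x + y (y x))"
      using LIMSEQ_unique[OF LIMSEQ_Suc[OF y[of x]]] by blast
    from arg_cong[OF this, of "\<lambda>z. 2 *\<^sub>C z"] have "2 *\<^sub>C y x = T x + y (y x)"
      by (simp add: scaleC_scaleC)
    then show ?thesis by simp
  qed
  have comm_n: "?y n (h x) = h (?y n x)" for n x
  proof (induct n arbitrary: x)
    case 0 show ?case using EE.adjoint_zero[OF h] by simp
  next
    case (Suc n)
    then show ?case
      by (simp add: EE.adjoint_scaleC[OF h] EE.adjoint_add[OF h] hT)
  qed
  have comm: "y (h x) = h (y x)" for x
    using LIMSEQ_unique[OF y[of "h x"], of "h (y x)"] tendsto_adjointable[OF h y[of x]]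
    by (simp add: comm_n)
  show ?thesis using that[OF y_sa y_fix comm] .
qed

text \<open>A self-adjoint contraction is the real part of the unitary \<open>h + i sqrt (1 - h\<^sup>2)\<close>.\<close>

lemma selfadjoint_real_part_unitary:
  assumes h: "is_adjoint E E h h" and h_norm: "\<And>x. norm (h x) \<le> 1/2 * norm x"
  obtains v v' where "is_adjoint E E v v'" "v' \<circ> v = id" "v \<circ> v' = id"
    "h = (\<lambda>x. (1/2) *\<^sub>C (v x + v' x))"
proof -
  have T: "is_adjoint E E (\<lambda>x. h (h x)) (\<lambda>x. h (h x))"
    using is_adjoint_comp[OF h h] by (simp add: o_def)
  have "norm (h (h x)) \<le> 1/4 * norm x" for x
    using h_norm[of "h x"] h_norm[of x] by simp
  then obtain y where y: "is_adjoint E E y y" "\<And>x. y (y x) = 2 *\<^sub>C y x - h (h x)"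
      "\<And>x. y (h x) = h (y x)"
    using one_minus_sqrt[OF T _ h] by blast
  \<comment> \<open>This is the square root of 1 - h^2: the equation for \<open>y\<close> gives c^2
    = 1 - 2 y + y^2 = 1 - h^2.\<close>
  define c where "c x = x - y x" for x
  have c: "is_adjoint E E c c"
    using y(1) by (simp add: is_adjoint_iff c_def E_simps)
  have two: "2 *\<^sub>C z = z + z" for z :: 'e
    using scaleC_add_left[of 1 1 z] by simp
  have c_diff: "c (x - z) = c x - c z" and h_diff: "h (x - z) = h x - h z" for x z
    using EE.adjoint_add[OF c, of "x - z" z] EE.adjoint_add[OF h, of "x - z" z] by (simp_all add: eq_diff_eq)
  have cc: "c (c x) = x - h (h x)" for x
    using y(2)[of x] c_diff[of x "y x"] by (simp add: c_def two)
  \<comment> \<open>Commutation cancels the mixed terms in the products of \<open>v\<close> and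
    \<open>v'\<close>, leaving h^2 + c^2 = 1.\<close>
  have ch: "c (h x) = h (c x)" for x
    by (simp add: c_def y(3) h_diff)
  define v v' where "v x = h x + \<i> *\<^sub>C c x" and "v' x = h x + (-\<i>) *\<^sub>C c x" for x
  note lin = EE.adjoint_add[OF h, simplified] EE.adjoint_scaleC[OF h, simplified]
    EE.adjoint_add[OF c, simplified] EE.adjoint_scaleC[OF c, simplified]
  show ?thesis
  proof (rule that)
    show "is_adjoint E E v v'"
      using is_adjoint_add[OF h is_adjoint_scale[OF c, of \<i>]] unfolding v_def v'_def by simp
    show "v' \<circ> v = id"
    proof
      fix x
      have "v' (v x) = h (h x) + c (c x)"
        unfolding v_def v'_def by (simp add: lin ch scaleC_add_right scaleC_scaleC complex_vector.scale_minus_left)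
      then show "(v' \<circ> v) x = id x" by (simp add: cc)
    qed
    show "v \<circ> v' = id"
    proof
      fix x
      have "v (v' x) = h (h x) + c (c x)"
        unfolding v_def v'_def
        by (simp add: lin ch h_diff c_diff complex_vector.scale_right_diff_distrib scaleC_add_right scaleC_scaleC complex_vector.scale_minus_left)
      then show "(v \<circ> v') x = id x" by (simp add: cc)
    qed
    show "h = (\<lambda>x. (1/2) *\<^sub>C (v x + v' x))"
      by (rule ext) (simp add: v_def v'_def complex_vector.scale_minus_left scaleC_scaleC scaleC_add_right
          flip: scaleC_add_left)
  qed
qed

end


section \<open>Unitary extensions and strict endomorphisms\<close>

text \<open>The relation \<open>R1\<close> is linear and closed, but with no totality of the
  \<open>g i\<close> it gives no norm bound. \<open>R2\<close> also demands the right inner product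
  with every pair in \<open>R1\<close>; tested on the pair itself this is isometry, which
  \<open>total_relation\<close> needs. The last clause of the conclusion later provides the
  adjoint.\<close>

lemma (in hilbert_pair) isometric_extension:
  assumes f: "\<And>i. i \<in> I \<Longrightarrow> f i \<in> carr M" and g: "\<And>i. i \<in> I \<Longrightarrow> g i \<in> carr N"
    and fg: "\<And>i k. i \<in> I \<Longrightarrow> k \<in> I \<Longrightarrow> inn N (g i) (g k) = inn M (f i) (f k)"
    and f_total: "closure (cspan (f ` I)) = carr M"
    and x: "x \<in> carr M"
  shows "\<exists>y. y \<in> carr N \<and> (\<forall>i\<in>I. inn N (g i) y = inn M (f i) x) \<and>
    (\<forall>x'\<in>carr M. \<forall>y'\<in>carr N. (\<forall>i\<in>I. inn N (g i) y' = inn M (f i) x') \<longrightarrow> inn N y y' = inn M x x')"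
proof -
  define R1 where "R1 x y \<longleftrightarrow> x \<in> carr M \<and> y \<in> carr N \<and> (\<forall>i\<in>I. inn N (g i) y = inn M (f i) x)" for x y
  define R2 where "R2 x y \<longleftrightarrow> R1 x y \<and> (\<forall>x' y'. R1 x' y' \<longrightarrow> inn N y y' = inn M x x')" for x y
  have R1D: "x \<in> carr M" "y \<in> carr N" if "R1 x y" for x y
    using that by (auto simp: R1_def)
  have "\<exists>y. R2 x y"
  proof (rule M.total_relation[where C = 1 and R = R2, OF N.hilbert_module_axioms f_total])
    show "\<exists>y. R2 d y" if "d \<in> f ` I" for d
    proof -
      obtain i where i: "i \<in> I" "d = f i" using \<open>d \<in> f ` I\<close> by blast
      then have "R2 d (g i)" by (simp add: R2_def R1_def f g fg)
      then show ?thesis ..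
    qed
    show "R2 (x + x') (y + y')" if "R2 x y" "R2 x' y'" for x y x' y'
    proof -
      have R1: "R1 x y" "R1 x' y'" using that by (auto simp: R2_def)
      then have "R1 (x + x') (y + y')"
        using f g by (auto simp: R1_def M.inn_add_right N.inn_add_right)
      moreover have "inn N (y + y') y'' = inn M (x + x') x''" if "R1 x'' y''" for x'' y''
        using that R1D[OF that] R1D[OF R1(1)] R1D[OF R1(2)] \<open>R2 x y\<close> \<open>R2 x' y'\<close>
        by (simp add: R2_def M.inn_add_left N.inn_add_left)
      ultimately show ?thesis by (simp add: R2_def)
    qed
    show "R2 (c *\<^sub>C x) (c *\<^sub>C y)" if "R2 x y" for c x y
    proof -
      have R1: "R1 x y" using that by (auto simp: R2_def)
      then have "R1 (c *\<^sub>C x) (c *\<^sub>C y)"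
        using f g by (auto simp: R1_def M.inn_scaleC_right N.inn_scaleC_right)
      moreover have "inn N (c *\<^sub>C y) y'' = inn M (c *\<^sub>C x) x''" if "R1 x'' y''" for x'' y''
        using that R1D[OF that] R1D[OF R1] \<open>R2 x y\<close>
        by (simp add: R2_def M.inn_scaleC_left N.inn_scaleC_left)
      ultimately show ?thesis by (simp add: R2_def)
    qed
    show "norm y \<le> 1 * norm x" if "R2 x y" for x y
    proof -
      have "inn N y y = inn M x x" "x \<in> carr M" "y \<in> carr N"
        using that by (auto simp: R2_def R1_def)
      then show ?thesis by (simp add: M.norm_inn N.norm_inn)
    qed
    show "R2 0 0" using f g by (simp add: R2_def R1_def)
    show "R2 x y" if R: "\<And>n. R2 (p n) (q n)" and lim: "p \<longlonglongrightarrow> x" "q \<longlonglongrightarrow> y" for p q x y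
    proof -
      have pq: "p n \<in> carr M" "q n \<in> carr N" for n using R by (auto simp: R2_def R1_def)
      have xy: "x \<in> carr M" "y \<in> carr N" using pq lim M.carr_lim N.carr_lim by blast+
      have "inn N (g i) y = inn M (f i) x" if i: "i \<in> I" for i
      proof -
        have "(\<lambda>n. inn N (g i) (q n)) \<longlonglongrightarrow> inn N (g i) y" "(\<lambda>n. inn M (f i) (p n)) \<longlonglongrightarrow> inn M (f i) x"
          using pq lim f g i by (auto intro!: M.tendsto_inn N.tendsto_inn)
        moreover have "inn N (g i) (q n) = inn M (f i) (p n)" for n
          using R[of n] i by (auto simp: R2_def R1_def)
        ultimately show ?thesis by (simp add: LIMSEQ_unique)
      qed
      moreover have "inn N y y' = inn M x x'" if R1: "R1 x' y'" for x' y'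
      proof -
        have "(\<lambda>n. inn N (q n) y') \<longlonglongrightarrow> inn N y y'" "(\<lambda>n. inn M (p n) x') \<longlonglongrightarrow> inn M x x'"
          using pq lim R1 by (auto intro!: M.tendsto_inn N.tendsto_inn simp: R1_def)
        moreover have "inn N (q n) y' = inn M (p n) x'" for n
          using R[of n] R1 by (auto simp: R2_def)
        ultimately show ?thesis by (simp add: LIMSEQ_unique)
      qed
      ultimately show ?thesis using xy by (simp add: R2_def R1_def)
    qed
  qed (auto simp: R2_def R1_def x)
  then show ?thesis by (auto simp: R2_def R1_def)
qed

text \<open>The previous lemma is applied in both directions. The two maps obey the same relation
  \<open>R1\<close>, read in opposite directions: its last clause makes them adjoint to each other,
  and totality on each side makes them inverse.\<close>

lemma (in hilbert_pair) unitary_extension: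
  assumes f: "\<And>i. i \<in> I \<Longrightarrow> f i \<in> carr M" and g: "\<And>i. i \<in> I \<Longrightarrow> g i \<in> carr N"
    and fg: "\<And>i k. i \<in> I \<Longrightarrow> k \<in> I \<Longrightarrow> inn N (g i) (g k) = inn M (f i) (f k)"
    and f_total: "closure (cspan (f ` I)) = carr M"
    and g_total: "closure (cspan (g ` I)) = carr N"
  obtains u where "hunitary M N u" "\<And>i. i \<in> I \<Longrightarrow> u (f i) = g i"
proof -
  interpret NM: hilbert_pair N M ..
  define R1 where "R1 x y \<longleftrightarrow> (\<forall>i\<in>I. inn N (g i) y = inn M (f i) x)" for x y
  obtain u where u: "\<And>x. x \<in> carr M \<Longrightarrow> u x \<in> carr N" "\<And>x. x \<in> carr M \<Longrightarrow> R1 x (u x)"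
      "\<And>x x' y'. \<lbrakk>x \<in> carr M; x' \<in> carr M; y' \<in> carr N; R1 x' y'\<rbrakk> \<Longrightarrow> inn N (u x) y' = inn M x x'"
    using isometric_extension[OF f g fg f_total] unfolding R1_def by metis
  obtain u' where u': "\<And>y. y \<in> carr N \<Longrightarrow> u' y \<in> carr M" "\<And>y. y \<in> carr N \<Longrightarrow> R1 (u' y) y"
    using NM.isometric_extension[OF g f fg[symmetric] g_total] unfolding R1_def by metis
  have uniq_M: "x = x'" if "x \<in> carr M" "x' \<in> carr M" "R1 x y" "R1 x' y" for x x' y
    by (rule M.inn_eqI[OF _ _ f_total]) (use that in \<open>auto simp: R1_def\<close>)
  have uniq_N: "y = y'" if "y \<in> carr N" "y' \<in> carr N" "R1 x y" "R1 x y'" for x y y'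
    by (rule N.inn_eqI[OF _ _ g_total]) (use that in \<open>auto simp: R1_def\<close>)
  show ?thesis
  proof (rule that)
    show "hunitary M N u"
      unfolding hunitary_def is_adjoint_def
    proof (intro exI[of _ u'] conjI ballI)
      show "u' (u x) = x" if "x \<in> carr M" for x
        by (rule uniq_M[of _ _ "u x"]) (use that u u' in auto)
      show "u (u' y) = y" if "y \<in> carr N" for y
        by (rule uniq_N[of _ _ "u' y"]) (use that u u' in auto)
    qed (use u u' in auto)
    show "u (f i) = g i" if "i \<in> I" for i
      by (rule uniq_N[of _ _ "f i"]) (use that u f g fg in \<open>auto simp: R1_def\<close>)
  qed
qed

section \<open>A single strict endomorphism: norm bound and rank-one strictness\<close>

locale strict_endo = hilbert_type E
  for E :: "('b::cstar_algebra, 'e::complex_normed_vector, 'm) hmodule_scheme" +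
  fixes T :: "('e \<Rightarrow> 'e) \<Rightarrow> ('e \<Rightarrow> 'e)"
  assumes T_adj: "is_adjoint E E a b \<Longrightarrow> is_adjoint E E (T a) (T b)"
    and T_add: "a \<in> Ba E \<Longrightarrow> b \<in> Ba E \<Longrightarrow> T (\<lambda>x. a x + b x) = (\<lambda>x. T a x + T b x)"
    and T_scale: "a \<in> Ba E \<Longrightarrow> T (\<lambda>x. c *\<^sub>C a x) = (\<lambda>x. c *\<^sub>C T a x)"
    and T_mult: "a \<in> Ba E \<Longrightarrow> b \<in> Ba E \<Longrightarrow> T (a \<circ> b) = T a \<circ> T b"
    and T_id: "T id = id"
    and T_strict: "closure (cspan {T k x | k x. k \<in> Kop E}) = UNIV"
begin

lemma T_selfadjoint_bound:
  assumes h: "is_adjoint E E h h" and h_norm: "\<And>x. norm (h x) \<le> 1/2 * norm x"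
  shows "norm (T h z) \<le> norm z"
proof -
  obtain v v' where v: "is_adjoint E E v v'" and vv: "v' \<circ> v = id" "v \<circ> v' = id"
      and hv: "h = (\<lambda>x. (1/2) *\<^sub>C (v x + v' x))"
    using selfadjoint_real_part_unitary[OF assms] by metis
  have v': "is_adjoint E E v' v" by (rule EE.is_adjoint_sym[OF v])
  \<comment> \<open>Multiplicativity and unitality make \<open>T b\<close> a left inverse of
    \<open>T a\<close>, of which it is also the adjoint.\<close>
  have iso: "norm (T a x) = norm x" if a: "is_adjoint E E a b" and ba: "b \<circ> a = id" for a b x
  proof -
    have "T b (T a x) = x"
      using fun_cong[OF T_mult[OF BaI[OF EE.is_adjoint_sym[OF a]] BaI[OF a]], of x] by (simp add: ba T_id)
    then have "inn E (T a x) (T a x) = inn E x x"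
      using adjoint_E[OF T_adj[OF a], of x "T a x"] by simp
    then show ?thesis by (simp add: norm_inn)
  qed
  have "T h z = (1/2) *\<^sub>C (T v z + T v' z)"
    unfolding hv using T_scale[OF BaI[OF is_adjoint_add[OF v v']]] T_add[OF BaI[OF v] BaI[OF v']] by simp
  also have "norm \<dots> \<le> norm z"
    using norm_triangle_ineq[of "T v z" "T v' z"] iso[OF v vv(1)] iso[OF v' vv(2)]
    by (simp add: norm_scaleC norm_divide)
  finally show ?thesis .
qed

text \<open>Split \<open>a\<close> into real and imaginary part. The adjoint is bounded by 4 c, the
  4 coming from \<open>norm_inn_le\<close>, so each part is bounded by (c + 4 c) / 2. The
  self-adjoint case bounds the image of each part by 5 c, and the two parts add up to 10 c.\<close>

lemma T_bound:
  assumes a: "is_adjoint E E a b" and a_norm: "\<And>x. norm (a x) \<le> c * norm x" and c: "c > 0"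
  shows "norm (T a z) \<le> 10 * c * norm z"
proof -
  have b: "is_adjoint E E b a" by (rule EE.is_adjoint_sym[OF a])
  have b_norm: "norm (b y) \<le> 4 * c * norm y" for y
  proof (cases "b y = 0")
    case False
    have "(norm (b y))\<^sup>2 = norm (inn E (a (b y)) y)"
      using norm_sq[of "b y"] adjoint_E[OF a, of "b y" y] by simp
    also have "\<dots> \<le> 4 * norm (a (b y)) * norm y" by (rule norm_inn_le) auto
    also have "\<dots> \<le> 4 * (c * norm (b y)) * norm y"
      by (intro mult_right_mono mult_left_mono a_norm) auto
    finally have "norm (b y) * norm (b y) \<le> (4 * c * norm y) * norm (b y)"
      by (simp add: power2_eq_square mult_ac)
    then show ?thesis using False by simp
  qed (use c in simp)
  \<comment> \<open>This factor scales the bound 5/2 c of the two parts to the 1/2 demanded by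
    \<open>T_selfadjoint_bound\<close>.\<close>
  define r where "r = 1 / (5 * c)"
  have r: "r > 0" using c by (simp add: r_def)
  have self: "norm (T (\<lambda>x. complex_of_real r *\<^sub>C h x) z) \<le> norm z"
    if h: "is_adjoint E E h h" and hn: "\<And>x. norm (h x) \<le> 5/2 * c * norm x" for h
  proof (rule T_selfadjoint_bound)
    show "is_adjoint E E (\<lambda>x. complex_of_real r *\<^sub>C h x) (\<lambda>x. complex_of_real r *\<^sub>C h x)"
      using is_adjoint_scale[OF h, of "complex_of_real r"] by simp
    fix x
    have "norm (complex_of_real r *\<^sub>C h x) = r * norm (h x)"
      unfolding norm_scaleC norm_of_real using r by simp
    also have "\<dots> \<le> r * (5/2 * c * norm x)"
      using r by (intro mult_left_mono hn) auto
    also have "\<dots> = 1/2 * norm x" using c by (simp add: r_def)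
    finally show "norm (complex_of_real r *\<^sub>C h x) \<le> 1/2 * norm x" .
  qed
  have bound: "norm (T h z) \<le> 5 * c * norm z"
    if h: "is_adjoint E E h h" and hn: "\<And>x. norm (h x) \<le> 5/2 * c * norm x" for h
  proof -
    have "norm (complex_of_real r *\<^sub>C T h z) \<le> norm z"
      using self[OF h hn] by (simp add: T_scale[OF BaI[OF h]])
    then have "r * norm (T h z) \<le> norm z"
      unfolding norm_scaleC norm_of_real using r by simp
    then show ?thesis using c by (simp add: r_def field_simps)
  qed
  define h k where "h x = (1/2) *\<^sub>C (a x + b x)" and "k x = (-\<i>/2) *\<^sub>C (a x + (-1) *\<^sub>C b x)" for x
  have h: "is_adjoint E E h h"
    using is_adjoint_scale[OF is_adjoint_add[OF a b], of "1/2"] by (simp add: h_def[abs_def] add.commute)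
  have "is_adjoint E E k (\<lambda>x. cnj (-\<i>/2) *\<^sub>C (b x + cnj (-1) *\<^sub>C a x))"
    using is_adjoint_scale[OF is_adjoint_add[OF a is_adjoint_scale[OF b, of "-1"]], of "-\<i>/2"]
    unfolding k_def[abs_def] .
  moreover have "(\<lambda>x. cnj (-\<i>/2) *\<^sub>C (b x + cnj (-1) *\<^sub>C a x)) = k"
    by (rule ext) (simp add: k_def complex_vector.scale_minus_left complex_vector.scale_right_diff_distrib)
  ultimately have k: "is_adjoint E E k k" by simp
  have ab: "norm (a x) + norm (b x) \<le> 5 * c * norm x" for x
    using a_norm[of x] b_norm[of x] by simp
  have hn: "norm (h x) \<le> 5/2 * c * norm x" for x
    using norm_triangle_ineq[of "a x" "b x"] ab[of x] by (simp add: h_def norm_scaleC norm_divide)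
  have kn: "norm (k x) \<le> 5/2 * c * norm x" for x
    using norm_triangle_ineq4[of "a x" "b x"] ab[of x] by (simp add: k_def norm_scaleC norm_divide)
  have "a = (\<lambda>x. h x + \<i> *\<^sub>C k x)"
    by (rule ext) (simp add: h_def k_def scaleC_scaleC scaleC_add_right complex_vector.scale_right_diff_distrib
        flip: scaleC_add_left)
  then have "T a z = T h z + \<i> *\<^sub>C T k z"
    using T_add[OF BaI[OF h] BaI[OF is_adjoint_scale[OF k, of \<i>]]] T_scale[OF BaI[OF k], of \<i>] by simp
  then have "norm (T a z) \<le> norm (T h z) + norm (T k z)"
    using norm_triangle_ineq[of "T h z" "\<i> *\<^sub>C T k z"] by (simp add: norm_scaleC)
  then show ?thesis using bound[OF h hn] bound[OF k kn] by simp
qed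

text \<open>Adjointability is carried through the induction because \<open>T\<close> is known to be
  additive and homogeneous on \<open>Ba E\<close> only.\<close>

lemma T_finite_rank:
  "\<exists>a'. is_adjoint E E (\<lambda>z. \<Sum>i<n. c i *\<^sub>C rank1 E (x i) (y i) z) a' \<and>
    T (\<lambda>z. \<Sum>i<(n::nat). c i *\<^sub>C rank1 E (x i) (y i) z) w \<in> cspan {T (rank1 E x y) z | x y z. True}"
proof (induct n)
  case 0
  \<comment> \<open>Writing the zero operator as 0 times the identity lets homogeneity compute its
    image.\<close>
  have "T (\<lambda>x. 0 *\<^sub>C id x) w = 0"
    by (subst T_scale) (auto intro: BaI[OF is_adjoint_id])
  then have "T (\<lambda>x. 0) w = 0" by simp
  then show ?case by (auto simp: is_adjoint_iff complex_vector.span_zero intro!: exI[of _ "\<lambda>_. 0"])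
next
  case (Suc n)
  let ?s = "\<lambda>z. \<Sum>i<n. c i *\<^sub>C rank1 E (x i) (y i) z" and ?r = "rank1 E (x n) (y n)"
  obtain a' where s: "is_adjoint E E ?s a'" "T ?s w \<in> cspan {T (rank1 E x y) z | x y z. True}"
    using Suc by blast
  note r = is_adjoint_rank1[of "x n" "y n"]
  have sum: "(\<lambda>z. \<Sum>i<Suc n. c i *\<^sub>C rank1 E (x i) (y i) z) = (\<lambda>z. ?s z + c n *\<^sub>C ?r z)"
    by simp
  have "T ?r w \<in> cspan {T (rank1 E x y) z | x y z. True}"
    by (rule complex_vector.span_base) blast
  then show ?case unfolding sum
    using s is_adjoint_add[OF s(1) is_adjoint_scale[OF r, of "c n"]]
      T_add[OF BaI[OF s(1)] BaI[OF is_adjoint_scale[OF r, of "c n"]]] T_scale[OF BaI[OF r], of "c n"]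
    by (auto intro: complex_vector.span_add complex_vector.span_scale)
qed

text \<open>By \<open>T_bound\<close>, finite-rank approximants of a compact operator have images
  under \<open>T\<close> that converge at every vector \<open>w\<close>. Hence the vectors occurring
  in strictness lie in the closed span of those coming from rank-one operators.\<close>

lemma T_rank1_total: "closure (cspan {T (rank1 E x y) z | x y z. True}) = UNIV"
proof -
  let ?D = "cspan {T (rank1 E x y) z | x y z. True}"
  have "T k w \<in> closure ?D" if k: "k \<in> Kop E" for k w
  proof -
    have kB: "is_adjoint E E k (adj E k)" using k Ba_adj by (auto simp: Kop_def)
    \<comment> \<open>All properties of the n-th approximant are bundled, so that one choice yields
      the whole sequence.\<close>
    define Q where "Q n d \<longleftrightarrow> (\<exists>d'. is_adjoint E E (\<lambda>z. k z - d z) d') \<and> onorm (\<lambda>z. k z - d z) < 1 / real (Suc n)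
        \<and> T d w \<in> ?D \<and> T k w - T d w = T (\<lambda>z. k z - d z) w" for n d
    have "\<exists>d. Q n d" for n
    proof -
      have "1 / real (Suc n) > 0" by simp
      then obtain d where d: "d \<in> finite_rank E" "onorm (\<lambda>z. k z - d z) < 1 / real (Suc n)"
        using k unfolding Kop_def mem_Collect_eq by metis
      obtain m :: nat and c x y where d_eq: "d = (\<lambda>z. \<Sum>i<m. c i *\<^sub>C rank1 E (x i) (y i) z)"
        using d(1) unfolding finite_rank_def mem_Collect_eq by metis
      obtain d' where dd: "is_adjoint E E d d'" "T d w \<in> ?D"
        using T_finite_rank[where n=m and c=c and x=x and y=y and w=w]
        unfolding d_eq[symmetric] by (elim exE conjE)
      note m = is_adjoint_scale[OF dd(1), of "-1"]
      have eq: "(\<lambda>z. k z + (-1) *\<^sub>C d z) = (\<lambda>z. k z - d z)" by simp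
      have "T (\<lambda>z. k z + (-1) *\<^sub>C d z) w = T k w + (-1) *\<^sub>C T d w"
        by (simp only: T_add[OF BaI[OF kB] BaI[OF m]] T_scale[OF BaI[OF dd(1)]])
      then have "T k w - T d w = T (\<lambda>z. k z - d z) w" unfolding eq by simp
      then show ?thesis
        using d(2) dd(2) is_adjoint_add[OF kB m] unfolding eq Q_def by (intro exI conjI)
    qed
    then obtain d where "\<And>n. Q n (d n)" by metis
    then obtain d' where d: "\<And>n. is_adjoint E E (\<lambda>z. k z - d n z) (d' n)"
        "\<And>n. onorm (\<lambda>z. k z - d n z) < 1 / real (Suc n)" "\<And>n. T (d n) w \<in> ?D"
        "\<And>n. T k w - T (d n) w = T (\<lambda>z. k z - d n z) w"
      unfolding Q_def by metis
    have "(\<lambda>n. T (d n) w - T k w) \<longlonglongrightarrow> 0"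
    proof (rule Lim_null_comparison)
      show "(\<lambda>n. 10 * (1 / real (Suc n)) * norm w) \<longlonglongrightarrow> 0"
      proof -
        have "(\<lambda>n. 10 * (1 / real (Suc n)) * norm w) = (\<lambda>n. (10 * norm w) * inverse (real (Suc n)))"
          by (simp only: divide_inverse mult_ac mult_1_left)
        then show ?thesis
          using tendsto_mult_right_zero[OF LIMSEQ_inverse_real_of_nat, of "10 * norm w"] by (simp only:)
      qed
      have "norm (T (d n) w - T k w) \<le> 10 * (1 / real (Suc n)) * norm w" for n
      proof -
        have "norm (T (\<lambda>z. k z - d n z) w) \<le> 10 * (1 / real (Suc n)) * norm w"
        proof (rule T_bound[OF d(1)])
          fix x
          have "norm (k x - d n x) \<le> onorm (\<lambda>z. k z - d n z) * norm x"
            by (rule onorm[OF adjointable_bounded_linear[OF d(1)]])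
          also have "\<dots> \<le> 1 / real (Suc n) * norm x"
            using d(2)[of n] by (intro mult_right_mono) auto
          finally show "norm (k x - d n x) \<le> 1 / real (Suc n) * norm x" .
        qed simp
        then show ?thesis using d(4)[of n] by (simp add: norm_minus_commute)
      qed
      then show "\<forall>\<^sub>F n in sequentially. norm (T (d n) w - T k w) \<le> 10 * (1 / real (Suc n)) * norm w"
        by simp
    qed
    then have "(\<lambda>n. T (d n) w) \<longlonglongrightarrow> T k w" by (simp add: LIM_zero_iff)
    then show ?thesis using d(3) unfolding closure_sequential by (intro exI[of _ "\<lambda>n. T (d n) w"] conjI allI)
  qed
  then have "{T k x | k x. k \<in> Kop E} \<subseteq> closure ?D" by blast
  then have "cspan {T k x | k x. k \<in> Kop E} \<subseteq> closure ?D"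
    by (intro complex_vector.span_minimal csubspace_closure complex_vector.subspace_span)
  then have "closure (cspan {T k x | k x. k \<in> Kop E}) \<subseteq> closure ?D"
    by (rule closure_minimal) simp
  then show ?thesis using T_strict by auto
qed

end


section \<open>A single fibre\<close>

sublocale correspondence \<subseteq> hilbert_pair M M ..

locale strict_fibre = strict_endo E T + F: correspondence F
  for E :: "('b::cstar_algebra, 'e::complex_normed_vector, 'm) hmodule_scheme"
    and T :: "('e \<Rightarrow> 'e) \<Rightarrow> ('e \<Rightarrow> 'e)"
    and F :: "('b, 'p::complex_normed_vector) corr" +
  fixes j :: "'e \<Rightarrow> 'e \<Rightarrow> 'p"
  assumes j_total: "closure (cspan {j x y | x y. True}) = carr F"
    and inn_j: "inn F (j x y) (j x' y') = inn E y (T (rank1 E x x') y')"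
    and lact_j: "lact F b (j x y) = j (ract E x (star b)) y"
begin

sublocale EF: hilbert_pair E F ..
sublocale FE: hilbert_pair F E ..

lemma j_closed [simp]: "j x y \<in> carr F"
proof -
  have "j x y \<in> cspan {j x y | x y. True}" by (rule complex_vector.span_base) blast
  then show ?thesis using closure_subset j_total by blast
qed

lemma eq_if_inn_j_eq:
  assumes "\<xi> \<in> carr F" "\<eta> \<in> carr F" "\<And>x y. inn F (j x y) \<xi> = inn F (j x y) \<eta>"
  shows "\<xi> = \<eta>"
  by (rule F.inn_eqI[OF _ _ j_total]) (use assms in auto)

lemma T_rank1_adjoint: "is_adjoint E E (T (rank1 E x y)) (T (rank1 E y x))"
  by (rule T_adj[OF is_adjoint_rank1])

text \<open>Inside the inner product with a generator, multiplicativity of \<open>T\<close> merges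
  \<open>rank1 E p x\<close> with \<open>a\<close> into \<open>rank1 E p (b x)\<close>.\<close>

lemma j_T:
  assumes a: "is_adjoint E E a b"
  shows "j x (T a v) = j (b x) v"
proof (rule eq_if_inn_j_eq)
  fix p q
  have "rank1 E p x \<circ> a = rank1 E p (b x)"
    using EE.adjoint_inn'[OF a] by (simp add: rank1_def fun_eq_iff)
  then have "T (rank1 E p x) (T a v) = T (rank1 E p (b x)) v"
    using T_mult[OF BaI[OF is_adjoint_rank1[of p x]] BaI[OF a]] by (metis comp_apply)
  then show "inn F (j p q) (j x (T a v)) = inn F (j p q) (j (b x) v)"
    by (simp add: inn_j)
qed auto

text \<open>The inner product of \<open>y\<close> with a vector \<open>T (rank1 E a b) c\<close>
  equals that of \<open>j a y\<close> with \<open>j b c\<close>, and such vectors are total by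
  strictness.\<close>

lemma j_separates:
  assumes "\<And>x. j x y = j x y'" shows "y = y'"
proof (rule inn_eqI[OF _ _ T_rank1_total[folded carr_UNIV]])
  fix z assume "z \<in> {T (rank1 E x y) z | x y z. True}"
  then obtain a b c where z: "z = T (rank1 E a b) c" by blast
  have "inn E z v = inn F (j b c) (j a v)" for v
    unfolding z inn_j by (rule adjoint_E[OF T_rank1_adjoint])
  then show "inn E z y = inn E z y'" using assms by simp
qed auto

text \<open>The squared norm of \<open>j x v\<close> is the norm of the inner product of
  \<open>v\<close> with \<open>T (rank1 E x x) v\<close>. That operator is adjointable, hence
  bounded by some \<open>C\<close>, and the constant 4 of \<open>norm_inn_le\<close> gives 2 sqrt
  C.\<close>

lemma j_bounded:
  obtains C where "C \<ge> 0" "\<And>v. norm (j x v) \<le> C * norm v"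
proof -
  obtain C where C: "C \<ge> 0" "\<And>v. norm (T (rank1 E x x) v) \<le> C * norm v"
    using adjointable_bounded[OF T_rank1_adjoint[of x x]] by blast
  have "norm (j x v) \<le> 2 * sqrt C * norm v" for v
  proof -
    have "(norm (j x v))\<^sup>2 = norm (inn E v (T (rank1 E x x) v))"
      by (simp add: F.norm_sq inn_j)
    also have "\<dots> \<le> 4 * norm v * norm (T (rank1 E x x) v)" by (rule norm_inn_le) auto
    also have "\<dots> \<le> 4 * norm v * (C * norm v)" by (intro mult_left_mono C) auto
    also have "\<dots> = (2 * sqrt C * norm v)\<^sup>2" using C by (simp add: power_mult_distrib power2_eq_square)
    finally show ?thesis by (rule power2_le_imp_le) (use C in simp)
  qed
  then show ?thesis using that[of "2 * sqrt C"] C(1) by simp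
qed

text \<open>On a generator \<open>j y z\<close> the adjoint of \<open>j x\<close> must take the
  value \<open>T (rank1 E x y) z\<close>. The relation \<open>R\<close> is the adjointness condition
  itself; boundedness of \<open>j x\<close> bounds it and lets \<open>total_relation\<close> reach
  the whole fibre.\<close>

lemma creation_exists: "\<exists>l. is_adjoint F E l (j x)"
proof -
  obtain C where C: "C \<ge> 0" and j_norm: "\<And>v. norm (j x v) \<le> C * norm v"
    using j_bounded[of x] by blast
  define R where "R \<xi> e \<longleftrightarrow> \<xi> \<in> carr F \<and> (\<forall>v. inn E e v = inn F \<xi> (j x v))" for \<xi> e
  have "\<exists>e. R \<xi> e" if \<xi>: "\<xi> \<in> carr F" for \<xi>
  proof (rule F.total_relation[where C = "4 * C" and R = R, OF hilbert_module_axioms j_total])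
    show "\<exists>e. R d e" if "d \<in> {j x y | x y. True}" for d
    proof -
      obtain y z where d: "d = j y z" using \<open>d \<in> _\<close> by blast
      have "R d (T (rank1 E x y) z)"
        unfolding R_def d inn_j using adjoint_E[OF T_rank1_adjoint] by simp
      then show ?thesis ..
    qed
    show "R (\<xi> + \<xi>') (e + e')" if "R \<xi> e" "R \<xi>' e'" for \<xi> e \<xi>' e'
      using that by (simp add: R_def E_simps F.inn_add_left)
    show "R (c *\<^sub>C \<xi>) (c *\<^sub>C e)" if "R \<xi> e" for c \<xi> e
      using that by (simp add: R_def E_simps F.inn_scaleC_left)
    show "norm e \<le> 4 * C * norm \<xi>" if R: "R \<xi> e" for \<xi> e
    proof (cases "e = 0")
      case False
      have "(norm e)\<^sup>2 = norm (inn F \<xi> (j x e))"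
        using R norm_sq[of e] by (simp add: R_def)
      also have "\<dots> \<le> 4 * norm \<xi> * norm (j x e)" using R by (intro F.norm_inn_le) (auto simp: R_def)
      also have "\<dots> \<le> 4 * norm \<xi> * (C * norm e)" by (intro mult_left_mono j_norm) auto
      finally have "norm e * norm e \<le> (4 * C * norm \<xi>) * norm e"
        by (simp add: power2_eq_square mult_ac)
      then show ?thesis using False by simp
    qed (use C in simp)
    show "R \<xi> e" if R: "\<And>n. R (f n) (g n)" and lim: "f \<longlonglongrightarrow> \<xi>" "g \<longlonglongrightarrow> e" for f g \<xi> e
    proof -
      have f: "f n \<in> carr F" for n using R by (auto simp: R_def)
      have "inn E e v = inn F \<xi> (j x v)" for v
      proof -
        have "(\<lambda>n. inn E (g n) v) \<longlonglongrightarrow> inn E e v" "(\<lambda>n. inn F (f n) (j x v)) \<longlonglongrightarrow> inn F \<xi> (j x v)"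
          using lim f by (auto intro!: tendsto_inn F.tendsto_inn)
        moreover have "inn E (g n) v = inn F (f n) (j x v)" for n
          using R[of n] by (simp add: R_def)
        ultimately show ?thesis by (simp add: LIMSEQ_unique)
      qed
      then show ?thesis using f lim F.carr_lim by (auto simp: R_def)
    qed
  qed (auto simp: R_def \<xi>)
  then obtain l where l: "\<And>\<xi>. \<xi> \<in> carr F \<Longrightarrow> R \<xi> (l \<xi>)" by metis
  show ?thesis
    unfolding is_adjoint_def using l by (intro exI[of _ l]) (auto simp: R_def)
qed

text \<open>The map \<open>\<xi> \<mapsto> x \<xi>\<close> of the identification of \<open>E \<odot> F\<close> with \<open>E\<close>; it is given by
  \<open>x (y\<^sup>* \<odot> z) = T (x y\<^sup>*) z\<close>.\<close>

definition creation :: "'e \<Rightarrow> 'p \<Rightarrow> 'e" where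
  "creation x = (SOME l. is_adjoint F E l (j x))"

lemma creation_adjoint: "is_adjoint F E (creation x) (j x)"
  unfolding creation_def by (rule someI_ex[OF creation_exists])

lemma j_adjoint: "is_adjoint E F (j x) (creation x)"
  by (rule FE.is_adjoint_sym[OF creation_adjoint])

lemma tendsto_j:
  assumes "f \<longlonglongrightarrow> v" shows "(\<lambda>n. j x (f n)) \<longlonglongrightarrow> j x v"
proof -
  obtain C where C: "\<And>v. norm (j x v) \<le> C * norm v" using j_bounded[of x] by blast
  have "(\<lambda>n. j x (f n) - j x v) \<longlonglongrightarrow> 0"
  proof (rule Lim_null_comparison)
    show "(\<lambda>n. C * norm (f n - v)) \<longlonglongrightarrow> 0"
      by (rule tendsto_mult_right_zero[OF tendsto_norm_zero[OF LIM_zero[OF assms]]])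
    have "j x (f n) - j x v = j x (f n - v)" for n
      using EF.adjoint_add[OF j_adjoint, of "f n - v" v] by simp
    then show "\<forall>\<^sub>F n in sequentially. norm (j x (f n) - j x v) \<le> C * norm (f n - v)"
      using C by simp
  qed
  then show ?thesis by (simp add: LIM_zero_iff)
qed

lemma creation_j: "creation x (j y z) = T (rank1 E x y) z"
proof (rule inn_eqI_left)
  fix v
  have "inn E (creation x (j y z)) v = inn F (j y z) (j x v)"
    by (rule FE.adjoint_inn[OF creation_adjoint]) auto
  also have "\<dots> = inn E (T (rank1 E x y) z) v"
    unfolding inn_j by (rule adjoint_E[OF T_rank1_adjoint, symmetric])
  finally show "inn E (creation x (j y z)) v = inn E (T (rank1 E x y) z) v" .
qed auto

text \<open>Tested against \<open>j y v\<close>, the left side brings in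
  \<open>T (rank1 E x y) v\<close>. By \<open>j_T\<close> the operator moves to \<open>x'\<close>
  and produces y times \<open>inn E x x'\<close>, which \<open>lact_j\<close> recognises as a left
  action.\<close>

lemma j_creation:
  assumes \<xi>: "\<xi> \<in> carr F"
  shows "j x (creation x' \<xi>) = lact F (inn E x x') \<xi>"
proof (rule eq_if_inn_j_eq)
  fix y v
  have "inn F (j y v) (j x (creation x' \<xi>)) = inn E (creation x (j y v)) (creation x' \<xi>)"
    by (rule FE.adjoint_inn[OF creation_adjoint, symmetric]) auto
  also have "\<dots> = inn F (j x' (T (rank1 E x y) v)) \<xi>"
    unfolding creation_j by (rule FE.adjoint_inn'[OF creation_adjoint \<xi>]) auto
  also have "\<dots> = inn F (j (ract E y (inn E x x')) v) \<xi>"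
    unfolding j_T[OF is_adjoint_rank1] by (simp add: rank1_def)
  also have "\<dots> = inn F (lact F (star (inn E x x')) (j y v)) \<xi>"
    by (simp add: lact_j star_star)
  also have "\<dots> = inn F (j y v) (lact F (inn E x x') \<xi>)"
    using F.adjoint_inn[OF F.lact_adjoint[of "star (inn E x x')"] _ \<xi>] by (simp add: star_star)
  finally show "inn F (j y v) (j x (creation x' \<xi>)) = inn F (j y v) (lact F (inn E x x') \<xi>)" .
qed (use \<xi> F.adjoint_closed[OF F.lact_adjoint] in auto)

text \<open>These are the inner products of elementary tensors. With \<open>creation_total\<close>
  they identify the interior tensor product of \<open>E\<close> and \<open>F\<close> with
  \<open>E\<close>.\<close>

lemma inn_creation:
  assumes "\<xi> \<in> carr F" "\<eta> \<in> carr F"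
  shows "inn E (creation x \<xi>) (creation y \<eta>) = inn F \<xi> (lact F (inn E x y) \<eta>)"
  using FE.adjoint_inn[OF creation_adjoint assms(1), of "creation y \<eta>" x] by (simp add: j_creation assms)

lemma creation_total: "closure (cspan {creation x \<xi> | x \<xi>. \<xi> \<in> carr F}) = UNIV"
proof -
  have "{T (rank1 E x y) z | x y z. True} \<subseteq> {creation x \<xi> | x \<xi>. \<xi> \<in> carr F}"
    using j_closed by (fastforce simp flip: creation_j)
  then have "closure (cspan {T (rank1 E x y) z | x y z. True})
      \<subseteq> closure (cspan {creation x \<xi> | x \<xi>. \<xi> \<in> carr F})"
    by (intro closure_mono complex_vector.span_mono)
  then show ?thesis using T_rank1_total by auto
qed

end

section \<open>Fibre isomorphisms and intertwining unitaries\<close>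

locale strict_fibres = A: strict_fibre E T F j + B: strict_fibre E T' F' j'
  for E :: "('b::cstar_algebra, 'e::complex_normed_vector, 'm) hmodule_scheme"
    and T T' :: "('e \<Rightarrow> 'e) \<Rightarrow> ('e \<Rightarrow> 'e)"
    and F :: "('b, 'p::complex_normed_vector) corr"
    and F' :: "('b, 'q::complex_normed_vector) corr"
    and j j'
begin

sublocale FF: hilbert_pair F F' ..

text \<open>Left linearity of \<open>w\<close> makes the prescription
  \<open>A.creation x \<xi>\<close> to \<open>B.creation x (w \<xi>)\<close> preserve inner
  products, and surjectivity of \<open>w\<close> makes its range total.\<close>

lemma unitary_of_fibre_isomorphism:
  assumes w: "bilinear_unitary F F' w"
  obtains u where "hunitary E E u" "\<And>x y. w (j x y) = j' x (u y)"
proof -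
  have w_unitary: "hunitary F F' w" and w_lact: "\<And>b \<xi>. \<xi> \<in> carr F \<Longrightarrow> w (lact F b \<xi>) = lact F' b (w \<xi>)"
    using w by (auto simp: bilinear_unitary_def)
  have w_closed: "\<xi> \<in> carr F \<Longrightarrow> w \<xi> \<in> carr F'" for \<xi>
    by (rule FF.hunitary_closed[OF w_unitary])
  let ?I = "{i. snd i \<in> carr F}"
  let ?f = "\<lambda>i. A.creation (fst i) (snd i)" and ?g = "\<lambda>i. B.creation (fst i) (w (snd i))"
  obtain u where u: "hunitary E E u" "\<And>i. i \<in> ?I \<Longrightarrow> u (?f i) = ?g i"
  proof (rule A.EE.unitary_extension[of ?I ?f ?g])
    show "inn E (?g i) (?g k) = inn E (?f i) (?f k)" if "i \<in> ?I" "k \<in> ?I" for i k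
      using that by (simp add: A.inn_creation B.inn_creation w_closed FF.hunitary_inn[OF w_unitary]
          A.F.adjoint_closed[OF A.F.lact_adjoint] flip: w_lact)
    have "?f ` ?I = {A.creation x \<xi> | x \<xi>. \<xi> \<in> carr F}" by (auto simp: image_def Bex_def)
    then show "closure (cspan (?f ` ?I)) = carr E" using A.creation_total by simp
    have "{B.creation x \<xi> | x \<xi>. \<xi> \<in> carr F'} \<subseteq> ?g ` ?I"
    proof clarify
      fix x \<eta> assume "\<eta> \<in> carr F'"
      then obtain \<xi> where "\<xi> \<in> carr F" "w \<xi> = \<eta>" using FF.hunitary_surj[OF w_unitary] by blast
      then show "B.creation x \<eta> \<in> ?g ` ?I" by (intro image_eqI[of _ _ "(x, \<xi>)"]) auto
    qed
    then have "closure (cspan {B.creation x \<xi> | x \<xi>. \<xi> \<in> carr F'}) \<subseteq> closure (cspan (?g ` ?I))"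
      by (intro closure_mono complex_vector.span_mono)
    then show "closure (cspan (?g ` ?I)) = carr E" using B.creation_total by auto
  qed auto
  have u_creation: "u (A.creation x \<xi>) = B.creation x (w \<xi>)" if "\<xi> \<in> carr F" for x \<xi>
    using u(2)[of "(x, \<xi>)"] that by simp
  obtain u' where u': "is_adjoint E E u u'" using A.EE.hunitaryE[OF u(1)] by metis
  obtain w' where w': "is_adjoint F F' w w'" using FF.hunitaryE[OF w_unitary] by metis
  have "w (j x y) = j' x (u y)" for x y
  proof -
    \<comment> \<open>On a vector \<open>A.creation x' \<xi>\<close> both sides are the left action
      of \<open>inn E x x'\<close> on \<open>w \<xi>\<close>, and such vectors are total.\<close>
    have "(w \<circ> j x) y = (j' x \<circ> u) y"
    proof (rule B.EF.adjointable_eq_on_closure)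
      show "is_adjoint E F' (w \<circ> j x) (A.creation x \<circ> w')"
        by (rule is_adjoint_comp[OF A.j_adjoint w'])
      show "is_adjoint E F' (j' x \<circ> u) (u' \<circ> B.creation x)"
        by (rule is_adjoint_comp[OF u' B.j_adjoint])
      show "closure (cspan {A.creation x \<xi> | x \<xi>. \<xi> \<in> carr F}) = carr E"
        using A.creation_total by simp
      show "(w \<circ> j x) d = (j' x \<circ> u) d" if "d \<in> {A.creation x \<xi> | x \<xi>. \<xi> \<in> carr F}" for d
        using that by (auto simp: u_creation A.j_creation B.j_creation w_closed w_lact)
    qed simp
    then show ?thesis by simp
  qed
  then show ?thesis using that u(1) by blast
qed

text \<open>Under \<open>j\<close> and \<open>j'\<close> alike, \<open>a\<close> moves to the first
  argument, which \<open>w\<close> leaves unchanged.\<close>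

lemma intertwines:
  assumes w: "\<And>x y. w (j x y) = j' x (u y)" and a: "is_adjoint E E a b"
  shows "u (T a v) = T' a (u v)"
proof (rule B.j_separates)
  fix x
  show "j' x (u (T a v)) = j' x (T' a (u v))"
    by (simp add: A.j_T[OF a] B.j_T[OF a] flip: w)
qed

text \<open>The intertwining relation for rank-one operators matches the inner products of the
  generators. Left linearity holds on generators because the left action affects only their first
  argument.\<close>

lemma fibre_isomorphism_of_unitary:
  assumes u: "hunitary E E u" and uT: "\<And>a v. a \<in> Ba E \<Longrightarrow> T' a (u v) = u (T a v)"
  shows "\<exists>w. bilinear_unitary F F' w \<and> (\<forall>x y. w (j x y) = j' x (u y))"
proof -
  let ?f = "\<lambda>i. j (fst i) (snd i)" and ?g = "\<lambda>i. j' (fst i) (u (snd i))"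
  obtain w where w: "hunitary F F' w" "\<And>i. i \<in> UNIV \<Longrightarrow> w (?f i) = ?g i"
  proof (rule FF.unitary_extension[of UNIV ?f ?g])
    show "inn F' (?g i) (?g k) = inn F (?f i) (?f k)" for i k
      by (simp add: A.inn_j B.inn_j uT A.BaI[OF A.is_adjoint_rank1] A.EE.hunitary_inn[OF u])
    have "range ?f = {j x y | x y. True}" by (simp add: image_def)
    then show "closure (cspan (range ?f)) = carr F" using A.j_total by simp
    have "range ?g = {j' x y | x y. True}"
    proof (intro equalityI subsetI)
      fix \<eta> assume "\<eta> \<in> {j' x y | x y. True}"
      then obtain x y where "\<eta> = j' x y" by blast
      moreover obtain v where "u v = y" using A.EE.hunitary_surj[OF u, of y] by auto
      ultimately show "\<eta> \<in> range ?g" by (intro image_eqI[of _ _ "(x, v)"]) auto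
    qed auto
    then show "closure (cspan (range ?g)) = carr F'" using B.j_total by simp
  qed auto
  have wj: "w (j x y) = j' x (u y)" for x y using w(2)[of "(x, y)"] by simp
  obtain w' where w': "is_adjoint F F' w w'" using FF.hunitaryE[OF w(1)] by metis
  have "w (lact F b \<xi>) = lact F' b (w \<xi>)" if \<xi>: "\<xi> \<in> carr F" for b \<xi>
  proof -
    have "(w \<circ> lact F b) \<xi> = (lact F' b \<circ> w) \<xi>"
    proof (rule FF.adjointable_eq_on_closure[OF _ _ A.j_total _ \<xi>])
      show "is_adjoint F F' (w \<circ> lact F b) (lact F (star b) \<circ> w')"
        by (rule is_adjoint_comp[OF A.F.lact_adjoint w'])
      show "is_adjoint F F' (lact F' b \<circ> w) (w' \<circ> lact F' (star b))"
        by (rule is_adjoint_comp[OF w' B.F.lact_adjoint])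
    qed (auto simp: A.lact_j B.lact_j wj)
    then show ?thesis by simp
  qed
  moreover have "w (ract F \<xi> b) = ract F' (w \<xi>) b" if "\<xi> \<in> carr F" for b \<xi>
    by (rule FF.adjoint_ract[OF w' that])
  ultimately have "bilinear_unitary F F' w" using w(1) by (simp add: bilinear_unitary_def)
  then show ?thesis using wj by (intro exI[of _ w]) simp
qed

end


section \<open>Product systems\<close>

text \<open>This allows \<open>pid\<close> to be treated as an adjointable map, determined by its
  values on a total set.\<close>

lemma hilbert_module_trivial_corr: "hilbert_module (trivial_corr :: ('b::cstar_algebra, 'b) corr)"
proof
  have eq: "inn trivial_corr a b = star a * b" "ract trivial_corr a b = a * b" "carr trivial_corr = UNIV" for a b :: 'b
    by (simp_all add: trivial_corr_def)
  note eq [simp]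
  show "csubspace (carr (trivial_corr :: ('b, 'b) corr))" by simp
  show "complete (carr (trivial_corr :: ('b, 'b) corr))" by (simp add: complete_UNIV)
  fix x y z a b :: 'b and c
  show "ract trivial_corr x b \<in> carr trivial_corr" by simp
  show "ract trivial_corr (x + y) b = ract trivial_corr x b + ract trivial_corr y b"
    "ract trivial_corr x (a + b) = ract trivial_corr x a + ract trivial_corr x b"
    by (simp_all add: algebra_simps)
  show "ract trivial_corr (c *\<^sub>C x) b = c *\<^sub>C ract trivial_corr x b"
    "ract trivial_corr x (c *\<^sub>C b) = c *\<^sub>C ract trivial_corr x b"
    by (simp_all add: scaleC_mult_left scaleC_mult_right)
  show "ract trivial_corr x (a * b) = ract trivial_corr (ract trivial_corr x a) b"
    by (simp add: mult.assoc)
  show "inn trivial_corr x (y + z) = inn trivial_corr x y + inn trivial_corr x z"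
    by (simp add: algebra_simps)
  show "inn trivial_corr x (c *\<^sub>C y) = c *\<^sub>C inn trivial_corr x y"
    by (simp add: scaleC_mult_right)
  show "inn trivial_corr x (ract trivial_corr y b) = inn trivial_corr x y * b"
    by (simp add: mult.assoc)
  show "star (inn trivial_corr x y) = inn trivial_corr y x"
    by (simp add: star_mult star_star)
  show "cstar_positive (inn trivial_corr x x)"
    by (auto simp: cstar_positive_def)
  show "norm x = sqrt (norm (inn trivial_corr x x))"
    by (simp add: cstar_identity)
  show "x = 0" if "inn trivial_corr x x = 0"
    using that cstar_identity[of x] by simp
qed

text \<open>This extracts from the auxiliary tensor product what is used of it later: products stay
  in the fibre and have the inner products of elementary tensors.\<close>

lemma (in product_system) pmult_closed_inn:
  assumes st: "s \<in> S" "t \<in> S" "s + t \<in> S"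
    and x: "x \<in> carr (fib P s)" "x' \<in> carr (fib P s)" and y: "y \<in> carr (fib P t)" "y' \<in> carr (fib P t)"
  shows "pmult P s t x y \<in> carr (fib P (s + t))"
    and "inn (fib P (s + t)) (pmult P s t x y) (pmult P s t x' y')
      = inn (fib P t) y (lact (fib P t) (inn (fib P s) x x') y')"
proof -
  obtain T :: "('b, 'p) corr" and \<tau> u where T: "interior_tensor (fib P s) (fib P t) T \<tau>"
    and u: "bilinear_unitary T (fib P (s + t)) u"
    and p: "\<And>x y. x \<in> carr (fib P s) \<Longrightarrow> y \<in> carr (fib P t) \<Longrightarrow> pmult P s t x y = u (\<tau> x y)"
    using pmult_unitary[OF st(1,2)] by metis
  interpret T: correspondence T using T by (simp add: interior_tensor_def)
  interpret F: correspondence "fib P (s + t)" by (rule fib_correspondence[OF st(3)])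
  interpret hilbert_pair T "fib P (s + t)" ..
  have \<tau>: "\<tau> x y \<in> carr T" "\<tau> x' y' \<in> carr T"
    "inn T (\<tau> x y) (\<tau> x' y') = inn (fib P t) y (lact (fib P t) (inn (fib P s) x x') y')"
    using T x y by (simp_all add: interior_tensor_def)
  have u': "hunitary T (fib P (s + t)) u" using u by (simp add: bilinear_unitary_def)
  show "pmult P s t x y \<in> carr (fib P (s + t))"
    using p x y \<tau> hunitary_closed[OF u'] by simp
  show "inn (fib P (s + t)) (pmult P s t x y) (pmult P s t x' y')
      = inn (fib P t) y (lact (fib P t) (inn (fib P s) x x') y')"
    using p x y \<tau> hunitary_inn[OF u'] by simp
qed

section \<open>A strict semigroup with the generators of its product system\<close>

locale associated_system = hilbert_type E + sg: E0_semigroup S E \<theta> + P: product_system S P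
  for S and E :: "('b::cstar_algebra, 'e::complex_normed_vector, 'm) hmodule_scheme"
    and \<theta> and P :: "('b, 'p::complex_normed_vector) psystem" +
  fixes j :: "real \<Rightarrow> 'e \<Rightarrow> 'e \<Rightarrow> 'p"
  assumes zero_in_S: "0 \<in> S" and add_in_S: "s \<in> S \<Longrightarrow> t \<in> S \<Longrightarrow> s + t \<in> S"
    and strict: "strict S E \<theta>"
    and fib_total: "t \<in> S \<Longrightarrow> closure (cspan {j t x y | x y. True}) = carr (fib P t)"
    and fib_inn: "t \<in> S \<Longrightarrow> inn (fib P t) (j t x y) (j t x' y') = inn E y (\<theta> t (rank1 E x x') y')"
    and fib_lact: "t \<in> S \<Longrightarrow> lact (fib P t) b (j t x y) = j t (ract E x (star b)) y"
    and pmult_j: "s \<in> S \<Longrightarrow> t \<in> S \<Longrightarrow>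
      pmult P s t (j s x x') (j t y y') = j (s + t) x (\<theta> t (rank1 E x' y) y')"
    and pid_j: "j 0 x y = pid P (inn E x y)"
begin

lemma strict_endo:
  assumes t: "t \<in> S" shows "strict_endo E (\<theta> t)"
proof
  fix a b assume ab: "is_adjoint E E a b"
  have "\<theta> t b = adj E (\<theta> t a)" using sg.adjoint[OF t BaI[OF ab]] adj_eq[OF ab] by simp
  then show "is_adjoint E E (\<theta> t a) (\<theta> t b)"
    using Ba_adj[OF sg.maps_Ba[OF t BaI[OF ab]]] by simp
next
  show "closure (cspan {\<theta> t k x | k x. k \<in> Kop E}) = UNIV"
    using strict t by (simp add: strict_def)
qed (use sg.add sg.scale sg.mult sg.unital t in auto)

lemma strict_fibre:
  assumes t: "t \<in> S" shows "strict_fibre E (\<theta> t) (fib P t) (j t)"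
proof -
  interpret strict_endo E "\<theta> t" by (rule strict_endo[OF t])
  interpret F: correspondence "fib P t" by (rule P.fib_correspondence[OF t])
  show ?thesis
    by unfold_locales (use t fib_total fib_inn fib_lact in auto)
qed

end

section \<open>The two directions of the equivalence\<close>

locale associated_systems = A: associated_system S E \<theta> P j + B: associated_system S E \<theta>' P' j'
  for S and E :: "('b::cstar_algebra, 'e::complex_normed_vector, 'm) hmodule_scheme"
    and \<theta> \<theta>' and P :: "('b, 'p::complex_normed_vector) psystem"
    and P' :: "('b, 'q::complex_normed_vector) psystem" and j j'
begin

lemma strict_fibres:
  assumes t: "t \<in> S" shows "strict_fibres E (\<theta> t) (\<theta>' t) (fib P t) (fib P' t) (j t) (j' t)"
  unfolding strict_fibres_def using A.strict_fibre[OF t] B.strict_fibre[OF t] by blast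

lemma rank1_adjointable: "is_adjoint E E a b \<Longrightarrow> rank1 E (a x) y = a \<circ> rank1 E x y"
  by (simp add: rank1_def fun_eq_iff A.EE.adjoint_ract)

lemma cocycle_of_isomorphism:
  assumes "psystem_isomorphic S P P'"
  shows "cocycle_equivalent S E \<theta> \<theta>'"
proof -
  obtain w where w: "\<And>t. t \<in> S \<Longrightarrow> bilinear_unitary (fib P t) (fib P' t) (w t)"
    and w_pid: "\<And>b. w 0 (pid P b) = pid P' b"
    and w_mult: "\<And>s t x y. \<lbrakk>s \<in> S; t \<in> S; x \<in> carr (fib P s); y \<in> carr (fib P t)\<rbrakk> \<Longrightarrow>
        pmult P' s t (w s x) (w t y) = w (s + t) (pmult P s t x y)"
    using assms unfolding psystem_isomorphic_def by metis
  have "\<exists>u. hunitary E E u \<and> (\<forall>x y. w t (j t x y) = j' t x (u y))" if "t \<in> S" for t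
    using strict_fibres.unitary_of_fibre_isomorphism[OF strict_fibres[OF that] w[OF that]] by metis
  then obtain u where u: "\<And>t. t \<in> S \<Longrightarrow> hunitary E E (u t)"
      and uj: "\<And>t x y. t \<in> S \<Longrightarrow> w t (j t x y) = j' t x (u t y)"
    by metis
  have "\<exists>u'. is_adjoint E E (u t) u' \<and> u t \<circ> u' = id" if t: "t \<in> S" for t
    by (rule A.EE.hunitaryE[OF u[OF t]]) (auto simp: fun_eq_iff)
  then obtain u' where u': "\<And>t. t \<in> S \<Longrightarrow> is_adjoint E E (u t) (u' t)" "\<And>t. t \<in> S \<Longrightarrow> u t \<circ> u' t = id"
    by metis
  have intertwines: "u t (\<theta> t a v) = \<theta>' t a (u t v)" if "t \<in> S" "is_adjoint E E a b" for t a b v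
    by (rule strict_fibres.intertwines[OF strict_fibres[OF that(1)] _ that(2)]) (rule uj[OF that(1)])
  show ?thesis
    unfolding cocycle_equivalent_def
  proof (intro exI[of _ u] conjI ballI)
    show "u t \<in> Ba E" "hunitary E E (u t)" if "t \<in> S" for t
      using u u' that A.BaI by blast+
    \<comment> \<open>Since \<open>w 0\<close> respects the identifications with the algebra,
      \<open>u 0 y\<close> and \<open>y\<close> have the same images under every
      \<open>j' 0 x\<close>.\<close>
    show "u 0 = id"
    proof
      fix y
      interpret B0: strict_fibre E "\<theta>' 0" "fib P' 0" "j' 0" by (rule B.strict_fibre[OF A.zero_in_S])
      show "u 0 y = id y"
      proof (rule B0.j_separates)
        fix x
        have "j' 0 x (u 0 y) = w 0 (pid P (inn E x y))"
          by (simp only: uj[OF A.zero_in_S, symmetric] A.pid_j)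
        then show "j' 0 x (u 0 y) = j' 0 x (id y)" by (simp add: w_pid B.pid_j)
      qed
    qed
    show "\<theta>' t a = u t \<circ> \<theta> t a \<circ> adj E (u t)" if t: "t \<in> S" and a: "a \<in> Ba E" for t a
    proof
      fix x
      have "u t (\<theta> t a (u' t x)) = \<theta>' t a (u t (u' t x))"
        by (rule intertwines[OF t A.Ba_adj[OF a]])
      also have "u t (u' t x) = x" using u'(2)[OF t] by (metis comp_apply id_apply)
      finally show "\<theta>' t a x = (u t \<circ> \<theta> t a \<circ> adj E (u t)) x"
        using A.adj_eq[OF u'(1)[OF t]] by simp
    qed
    fix s t assume s: "s \<in> S" and t: "t \<in> S"
    \<comment> \<open>The times are exchanged: in a product with right factor at time
      \<open>s\<close> the semigroup acts at time \<open>s\<close>, so the computation yields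
      \<open>u (t + s) = u s \<circ> \<theta> s (u t)\<close>. Commutativity of addition restores
      the stated form.\<close>
    have st: "t + s \<in> S" by (rule A.add_in_S[OF t s])
    interpret As: strict_fibre E "\<theta> s" "fib P s" "j s" by (rule A.strict_fibre[OF s])
    interpret At: strict_fibre E "\<theta> t" "fib P t" "j t" by (rule A.strict_fibre[OF t])
    interpret Bts: strict_fibre E "\<theta>' (t + s)" "fib P' (t + s)" "j' (t + s)" by (rule B.strict_fibre[OF st])
    have "u (t + s) v = (u s \<circ> \<theta> s (u t)) v" for v
    proof (rule A.EE.adjointable_eq_on_closure[where a = "u (t + s)" and b = "u s \<circ> \<theta> s (u t)"])
      show "is_adjoint E E (u (t + s)) (u' (t + s))" by (rule u'(1)[OF st])
      show "is_adjoint E E (u s \<circ> \<theta> s (u t)) (\<theta> s (u' t) \<circ> u' s)"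
        by (rule is_adjoint_comp[OF As.T_adj[OF u'(1)[OF t]] u'(1)[OF s]])
      show "closure (cspan {\<theta> s (rank1 E x y) z | x y z. True}) = carr E"
        using As.T_rank1_total by simp
      show "u (t + s) d = (u s \<circ> \<theta> s (u t)) d" if d_mem: "d \<in> {\<theta> s (rank1 E x y) z | x y z. True}" for d
      proof -
        obtain x y z where d: "d = \<theta> s (rank1 E x y) z" using d_mem by blast
        \<comment> \<open>The unitary \<open>u t\<close> inside the rank-one operator splits off as
          a left factor; multiplicativity of the endomorphism turns it into the second factor of the
          cocycle identity.\<close>
        have rank: "\<theta> s (rank1 E (u t x) y) z = \<theta> s (u t) d"
          unfolding d rank1_adjointable[OF u'(1)[OF t]]
          using As.T_mult[OF A.BaI[OF u'(1)[OF t]] A.BaI[OF A.is_adjoint_rank1]] by simp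
        have "u (t + s) d = u s (\<theta> s (u t) d)"
        proof (rule Bts.j_separates)
          fix p
          have "j' (t + s) p (u (t + s) d) = w (t + s) (pmult P t s (j t p x) (j s y z))"
            by (simp add: A.pmult_j s t st d uj)
          also have "\<dots> = pmult P' t s (j' t p (u t x)) (j' s y (u s z))"
            using w_mult[OF t s At.j_closed As.j_closed] by (simp add: uj s t)
          also have "\<dots> = j' (t + s) p (\<theta>' s (rank1 E (u t x) y) (u s z))"
            by (rule B.pmult_j[OF t s])
          also have "\<dots> = j' (t + s) p (u s (\<theta> s (u t) d))"
            by (simp only: intertwines[OF s A.is_adjoint_rank1, symmetric] rank)
          finally show "j' (t + s) p (u (t + s) d) = j' (t + s) p (u s (\<theta> s (u t) d))" .
        qed
        then show ?thesis by simp
      qed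
    qed simp
    then show "u (s + t) = u s \<circ> \<theta> s (u t)" by (auto simp: fun_eq_iff add.commute)
  qed
qed

text \<open>Each \<open>w t\<close> is built from \<open>u t\<close> on generators. The cocycle
  identity makes the family multiplicative there, and inner products extend this to all elements.
  Fullness enters at time 0, where the generators are images of inner products of
  \<open>E\<close>.\<close>

lemma isomorphism_of_cocycle:
  assumes full: "full E" and "cocycle_equivalent S E \<theta> \<theta>'"
  shows "psystem_isomorphic S P P'"
proof -
  obtain u where "\<forall>t\<in>S. u t \<in> Ba E \<and> hunitary E E (u t)" and u0: "u 0 = id"
    and "\<forall>s\<in>S. \<forall>t\<in>S. u (s + t) = u s \<circ> \<theta> s (u t)"
    and "\<forall>t\<in>S. \<forall>a\<in>Ba E. \<theta>' t a = u t \<circ> \<theta> t a \<circ> adj E (u t)"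
    using assms(2) unfolding cocycle_equivalent_def by (elim exE conjE)
  then have u: "t \<in> S \<Longrightarrow> hunitary E E (u t)"
    and cocycle: "s \<in> S \<Longrightarrow> t \<in> S \<Longrightarrow> u (s + t) = u s \<circ> \<theta> s (u t)"
    and conj: "t \<in> S \<Longrightarrow> a \<in> Ba E \<Longrightarrow> \<theta>' t a = u t \<circ> \<theta> t a \<circ> adj E (u t)" for s t a
    by blast+
  have u_adj: "\<exists>u'. is_adjoint E E (u t) u' \<and> (\<forall>x. u' (u t x) = x)" if t: "t \<in> S" for t
    using u[OF t] by (auto simp: hunitary_def)
  have uT: "\<theta>' t a (u t v) = u t (\<theta> t a v)" if t: "t \<in> S" and a: "a \<in> Ba E" for t a v
  proof -
    obtain u' where u': "is_adjoint E E (u t) u'" "\<And>x. u' (u t x) = x" using u_adj[OF t] by blast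
    show ?thesis by (simp add: conj[OF t a] A.adj_eq[OF u'(1)] u'(2))
  qed
  have "\<forall>t\<in>S. \<exists>w. bilinear_unitary (fib P t) (fib P' t) w \<and> (\<forall>x y. w (j t x y) = j' t x (u t y))"
  proof
    fix t assume t: "t \<in> S"
    interpret strict_fibres E "\<theta> t" "\<theta>' t" "fib P t" "fib P' t" "j t" "j' t" by (rule strict_fibres[OF t])
    show "\<exists>w. bilinear_unitary (fib P t) (fib P' t) w \<and> (\<forall>x y. w (j t x y) = j' t x (u t y))"
    proof (rule fibre_isomorphism_of_unitary[OF u[OF t]])
      show "\<theta>' t a (u t v) = u t (\<theta> t a v)" if "a \<in> Ba E" for a v by (rule uT[OF t that])
    qed
  qed
  from bchoice[OF this] obtain w where w: "\<And>t. t \<in> S \<Longrightarrow> bilinear_unitary (fib P t) (fib P' t) (w t)"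
      and wj: "\<And>t x y. t \<in> S \<Longrightarrow> w t (j t x y) = j' t x (u t y)"
    by blast
  have w': "hunitary (fib P t) (fib P' t) (w t)"
    and w_lact: "\<xi> \<in> carr (fib P t) \<Longrightarrow> w t (lact (fib P t) b \<xi>) = lact (fib P' t) b (w t \<xi>)"
    if "t \<in> S" for t b \<xi>
    using w[OF that] by (auto simp: bilinear_unitary_def)
  show ?thesis
    unfolding psystem_isomorphic_def
  proof (intro exI[of _ w] conjI ballI allI)
    show "bilinear_unitary (fib P t) (fib P' t) (w t)" if "t \<in> S" for t by (rule w[OF that])
  next
    fix b
    interpret strict_fibres E "\<theta> 0" "\<theta>' 0" "fib P 0" "fib P' 0" "j 0" "j' 0"
      by (rule strict_fibres[OF A.zero_in_S])
    interpret B: hilbert_module "trivial_corr :: ('b, 'b) corr" by (rule hilbert_module_trivial_corr)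
    interpret BF: hilbert_pair "trivial_corr :: ('b, 'b) corr" "fib P 0" ..
    interpret BF': hilbert_pair "trivial_corr :: ('b, 'b) corr" "fib P' 0" ..
    obtain p where p: "is_adjoint trivial_corr (fib P 0) (pid P) p"
      using A.P.pid_unitary by (auto simp: bilinear_unitary_def hunitary_def)
    obtain p' where p': "is_adjoint trivial_corr (fib P' 0) (pid P') p'"
      using B.P.pid_unitary by (auto simp: bilinear_unitary_def hunitary_def)
    obtain v where v: "is_adjoint (fib P 0) (fib P' 0) (w 0) v"
      using w'[OF A.zero_in_S] by (auto simp: hunitary_def)
    \<comment> \<open>Two adjointable maps on the algebra that agree on the inner products of
      \<open>E\<close>, which are total by fullness.\<close>
    have "(w 0 \<circ> pid P) b = pid P' b"
    proof (rule BF'.adjointable_eq_on_closure[OF is_adjoint_comp[OF p v] p'])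
      show "closure (cspan {inn E x y | x y. x \<in> carr E \<and> y \<in> carr E}) = carr trivial_corr"
        using full by (simp add: full_def trivial_corr_def)
      show "(w 0 \<circ> pid P) d = pid P' d" if d_mem: "d \<in> {inn E x y | x y. x \<in> carr E \<and> y \<in> carr E}" for d
      proof -
        obtain x y where "d = inn E x y" using d_mem by blast
        then show ?thesis
          using wj[OF A.zero_in_S, of x y] by (simp add: A.pid_j B.pid_j u0)
      qed
    qed (simp add: trivial_corr_def)
    then show "w 0 (pid P b) = pid P' b" by simp
  next
    fix s t \<xi> \<eta> assume s: "s \<in> S" and t: "t \<in> S" and \<xi>: "\<xi> \<in> carr (fib P s)" and \<eta>: "\<eta> \<in> carr (fib P t)"
    have st: "s + t \<in> S" by (rule A.add_in_S[OF s t])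
    interpret s: strict_fibres E "\<theta> s" "\<theta>' s" "fib P s" "fib P' s" "j s" "j' s" by (rule strict_fibres[OF s])
    interpret t: strict_fibres E "\<theta> t" "\<theta>' t" "fib P t" "fib P' t" "j t" "j' t" by (rule strict_fibres[OF t])
    interpret st: strict_fibres E "\<theta> (s + t)" "\<theta>' (s + t)" "fib P (s + t)" "fib P' (s + t)" "j (s + t)" "j' (s + t)"
      by (rule strict_fibres[OF st])
    note ws = s.FF.hunitary_closed[OF w'[OF s]] and wt = t.FF.hunitary_closed[OF w'[OF t]]
      and wst = st.FF.hunitary_closed[OF w'[OF st]]
    \<comment> \<open>The factor \<open>u s\<close> leaves the rank-one operator as
      \<open>\<theta> t (u s)\<close>, and the cocycle identity at the pair \<open>t\<close>,
      \<open>s\<close> absorbs it into \<open>u (s + t)\<close>.\<close>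
    have mult_j: "pmult P' s t (w s (j s x x')) (w t (j t y y')) = w (s + t) (pmult P s t (j s x x') (j t y y'))"
      for x x' y y'
    proof -
      obtain v where v: "is_adjoint E E (u s) v" using u_adj[OF s] by blast
      have "pmult P' s t (w s (j s x x')) (w t (j t y y')) = j' (s + t) x (\<theta>' t (rank1 E (u s x') y) (u t y'))"
        by (simp add: wj s t B.pmult_j)
      also have "\<theta>' t (rank1 E (u s x') y) (u t y') = u t (\<theta> t (rank1 E (u s x') y) y')"
        by (rule uT[OF t A.BaI[OF A.is_adjoint_rank1]])
      also have "\<theta> t (rank1 E (u s x') y) y' = \<theta> t (u s) (\<theta> t (rank1 E x' y) y')"
        unfolding rank1_adjointable[OF v]
        using t.A.T_mult[OF A.BaI[OF v] A.BaI[OF A.is_adjoint_rank1]] by simp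
      also have "u t (\<theta> t (u s) (\<theta> t (rank1 E x' y) y')) = u (s + t) (\<theta> t (rank1 E x' y) y')"
        using cocycle[OF t s] by (simp add: add.commute)
      also have "j' (s + t) x (u (s + t) (\<theta> t (rank1 E x' y) y')) = w (s + t) (pmult P s t (j s x x') (j t y y'))"
        by (simp add: A.pmult_j s t wj st)
      finally show ?thesis .
    qed
    have w_inn: "inn (fib P' s) (w s x) (w s y) = inn (fib P s) x y"
      if "x \<in> carr (fib P s)" "y \<in> carr (fib P s)" for x y
      by (rule s.FF.hunitary_inn[OF w'[OF s] that])
    \<comment> \<open>Products of generators are total in the fibre at \<open>s + t\<close>: by
      strictness at time \<open>t\<close>, every second argument of \<open>j' (s + t) x\<close> is a
      limit of combinations of vectors that occur in such products.\<close>
    let ?D = "{pmult P' s t (w s (j s x x')) (w t (j t y y')) | x x' y y'. True}"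
    have D: "closure (cspan ?D) = carr (fib P' (s + t))"
    proof
      have "?D \<subseteq> carr (fib P' (s + t))"
      proof (rule subsetI)
        fix d assume "d \<in> ?D"
        then obtain x x' y y' where d: "d = pmult P' s t (w s (j s x x')) (w t (j t y y'))" by blast
        show "d \<in> carr (fib P' (s + t))"
          unfolding d by (rule B.P.pmult_closed_inn(1)[OF s t st ws ws wt wt]) (rule s.A.j_closed t.A.j_closed)+
      qed
      then have "cspan ?D \<subseteq> carr (fib P' (s + t))"
        by (rule complex_vector.span_minimal[OF _ st.B.F.carr_subspace])
      then show "closure (cspan ?D) \<subseteq> carr (fib P' (s + t))"
        by (rule closure_minimal[OF _ st.B.F.carr_closed])
      have sub: "csubspace (closure (cspan ?D))"
        by (intro csubspace_closure complex_vector.subspace_span)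
      have "j' (s + t) x v \<in> closure (cspan ?D)" for x v
      proof -
        have "v \<in> closure (cspan {\<theta>' t (rank1 E x y) z | x y z. True})"
          using t.B.T_rank1_total by simp
        then show ?thesis
        proof (induct rule: closure_cspan_induct)
          case (base d)
          then obtain p y q where d: "d = \<theta>' t (rank1 E p y) q" by blast
          \<comment> \<open>Surjectivity of the unitaries puts arbitrary \<open>p\<close> and
            \<open>q\<close> into the form that occurs in \<open>?D\<close>.\<close>
          obtain x' y' where xy: "u s x' = p" "u t y' = q"
            using A.EE.hunitary_surj[OF u[OF s], of p] A.EE.hunitary_surj[OF u[OF t], of q] by auto
          have "j' (s + t) x d = pmult P' s t (w s (j s x x')) (w t (j t y y'))"
            by (simp add: d wj s t B.pmult_j xy)
          then show ?case
            using complex_vector.span_superset[of ?D] closure_subset by blast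
        next
          case zero
          then show ?case
            using sub by (simp add: st.B.EF.adjoint_zero[OF st.B.j_adjoint] complex_vector.subspace_0)
        next
          case (add a b)
          then show ?case
            using sub by (simp add: st.B.EF.adjoint_add[OF st.B.j_adjoint] complex_vector.subspace_add)
        next
          case (scale c a)
          then show ?case
            using sub by (simp add: st.B.EF.adjoint_scaleC[OF st.B.j_adjoint] complex_vector.subspace_scale)
        next
          case (lim f v)
          have "(\<lambda>n. j' (s + t) x (f n)) \<longlonglongrightarrow> j' (s + t) x v"
            by (rule st.B.tendsto_j[OF lim(2)])
          then show ?case by (rule closed_sequentially[OF closed_closure lim(1)])
        qed
      qed
      then have "{j' (s + t) x y | x y. True} \<subseteq> closure (cspan ?D)" by blast
      then have "cspan {j' (s + t) x y | x y. True} \<subseteq> closure (cspan ?D)"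
        by (rule complex_vector.span_minimal[OF _ sub])
      then have "closure (cspan {j' (s + t) x y | x y. True}) \<subseteq> closure (cspan ?D)"
        by (rule closure_minimal) simp
      then show "carr (fib P' (s + t)) \<subseteq> closure (cspan ?D)"
        by (simp only: B.fib_total[OF st])
    qed
    \<comment> \<open>Both sides have the same inner product with each element of \<open>?D\<close>:
      the tensor formula reduces it to the fibres at \<open>s\<close> and \<open>t\<close>, where
      the bilinear unitaries cancel, and \<open>mult_j\<close> leads back.\<close>
    show "pmult P' s t (w s \<xi>) (w t \<eta>) = w (s + t) (pmult P s t \<xi> \<eta>)"
    proof (rule st.B.F.inn_eqI[OF _ _ D])
      show "pmult P' s t (w s \<xi>) (w t \<eta>) \<in> carr (fib P' (s + t))"
        by (rule B.P.pmult_closed_inn(1)[OF s t st ws[OF \<xi>] ws[OF \<xi>] wt[OF \<eta>] wt[OF \<eta>]])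
      have p: "pmult P s t \<xi> \<eta> \<in> carr (fib P (s + t))"
        by (rule A.P.pmult_closed_inn(1)[OF s t st \<xi> \<xi> \<eta> \<eta>])
      show "w (s + t) (pmult P s t \<xi> \<eta>) \<in> carr (fib P' (s + t))"
        by (rule wst[OF p])
      fix d assume "d \<in> ?D"
      then obtain x x' y y' where d: "d = pmult P' s t (w s (j s x x')) (w t (j t y y'))" by blast
      let ?x = "j s x x'" and ?y = "j t y y'"
      have q: "pmult P s t ?x ?y \<in> carr (fib P (s + t))"
        by (rule A.P.pmult_closed_inn(1)[OF s t st s.A.j_closed s.A.j_closed t.A.j_closed t.A.j_closed])
      have "inn (fib P' (s + t)) d (pmult P' s t (w s \<xi>) (w t \<eta>))
          = inn (fib P' t) (w t ?y) (lact (fib P' t) (inn (fib P' s) (w s ?x) (w s \<xi>)) (w t \<eta>))"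
        unfolding d
        by (rule B.P.pmult_closed_inn(2)[OF s t st ws[OF s.A.j_closed] ws[OF \<xi>] wt[OF t.A.j_closed] wt[OF \<eta>]])
      also have "\<dots> = inn (fib P' t) (w t ?y) (w t (lact (fib P t) (inn (fib P s) ?x \<xi>) \<eta>))"
        by (simp only: w_inn[OF s.A.j_closed \<xi>] w_lact[OF t \<eta>])
      also have "\<dots> = inn (fib P t) ?y (lact (fib P t) (inn (fib P s) ?x \<xi>) \<eta>)"
        by (rule t.FF.hunitary_inn[OF w'[OF t] t.A.j_closed t.A.F.adjoint_closed[OF t.A.F.lact_adjoint \<eta>]])
      also have "\<dots> = inn (fib P (s + t)) (pmult P s t ?x ?y) (pmult P s t \<xi> \<eta>)"
        by (rule A.P.pmult_closed_inn(2)[OF s t st s.A.j_closed \<xi> t.A.j_closed \<eta>, symmetric])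
      also have "\<dots> = inn (fib P' (s + t)) (w (s + t) (pmult P s t ?x ?y)) (w (s + t) (pmult P s t \<xi> \<eta>))"
        by (rule st.FF.hunitary_inn[OF w'[OF st] q p, symmetric])
      also have "\<dots> = inn (fib P' (s + t)) d (w (s + t) (pmult P s t \<xi> \<eta>))"
        unfolding d mult_j ..
      finally show "inn (fib P' (s + t)) d (pmult P' s t (w s \<xi>) (w t \<eta>))
          = inn (fib P' (s + t)) d (w (s + t) (pmult P s t \<xi> \<eta>))" .
    qed
  qed
qed

end

theorem theorem6p5:
  fixes S :: "real set"
    and E :: "('b::cstar_algebra, 'e::complex_normed_vector) hmodule"
    and \<theta> \<theta>' :: "real \<Rightarrow> ('e \<Rightarrow> 'e) \<Rightarrow> ('e \<Rightarrow> 'e)"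
    and P :: "('b, 'p::complex_normed_vector) psystem"
    and P' :: "('b, 'q::complex_normed_vector) psystem"
  assumes "S = \<nat> \<or> S = {0..}"
    and "hilbert_module E" and "carr E = UNIV" and "full E"
    and "E0_semigroup S E \<theta>" and "strict S E \<theta>"
    and "E0_semigroup S E \<theta>'" and "strict S E \<theta>'"
    and "associated_psystem S E \<theta> P"
    and "associated_psystem S E \<theta>' P'"
  shows "psystem_isomorphic S P P' \<longleftrightarrow> cocycle_equivalent S E \<theta> \<theta>'"
proof -
  have S: "0 \<in> S" "\<And>s t. s \<in> S \<Longrightarrow> t \<in> S \<Longrightarrow> s + t \<in> S"
    using assms(1) by auto
  \<comment> \<open>The type variable \<open>'r\<close> stays general, because the fibres of
    \<open>P\<close> and \<open>P'\<close> live in different types.\<close>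
  have system: "\<exists>j. associated_system S E \<theta> P j"
    if E0: "E0_semigroup S E \<theta>" and strict: "strict S E \<theta>" and assoc: "associated_psystem S E \<theta> P"
    for \<theta> and P :: "('b, 'r::complex_normed_vector) psystem"
  proof -
    have E: "hilbert_type E"
      using assms(2,3) by (simp add: hilbert_type_def hilbert_type_axioms_def)
    show ?thesis
      using assoc unfolding associated_psystem_def assms(3)
    proof (elim conjE exE, goal_cases)
      case (1 j)
      then have "associated_system_axioms S E \<theta> P j"
        using S strict by (simp add: associated_system_axioms_def)
      then show ?case
        using E E0 1(1) by (auto simp: associated_system_def)
    qed
  qed
  obtain j j' where "associated_system S E \<theta> P j" "associated_system S E \<theta>' P' j'"
    using system[OF assms(5,6,9)] system[OF assms(7,8,10)] by blast
  then interpret associated_systems S E \<theta> \<theta>' P P' j j'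
    by (simp add: associated_systems_def)
  show ?thesis
    using cocycle_of_isomorphism isomorphism_of_cocycle[OF \<open>full E\<close>] by blast
qed

end
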